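(* Let $(\mathcal H,\mathcal S_0)$ be a Hilbert space and let $\mathcal B_0\in\mathcal L(\mathcal H)$ be a self-adjoint operator. Let $(\Lambda_\eta)_{\eta\in[0,1]}$ be a bounded-holomorphic family of automorphisms of $\mathcal H$, with $\Lambda_0=\mathrm{Id}$, such that each $\Lambda_\eta$ is self-adjoint and $\Lambda_{\eta_1}\le\Lambda_{\eta_2}$ (in the sense of self-adjoint operators) for all $0\le\eta_1\le\eta_2\le1$. For $\eta\in[0,1]$ let $\mathcal S_\eta$ be the scalar product on $\mathcal H$ defined by $\mathcal S_\eta(X,Y):=\langle X,\Lambda_\eta Y\rangle_0$ for all $X,Y\in\mathcal H$. Define also $\mathcal B_\eta:=\mathcal B_0\circ\Lambda_\eta$, and suppose that $\sigma_p(\mathcal B_\eta)=\{0\}$ for all $\eta\in[0,1]$. Let $\mathcal H_{\mathrm{cont},\eta}$ be the orthogonal complement of $\mathrm{Ker}\,\mathcal B_\eta$ in $\mathcal H$ with respect to $\mathcal S_\eta$, and let $\Pi_{\mathrm{cont},\eta}$ be the orthogonal (with respect to $\mathcal S_\eta$) projection onto $\mathcal H_{\mathrm{cont},\eta}$. Let $\sigma:[0,1]\to[0,1]$ be a continuous increasing function with $\sigma(0)=0$ and $\sigma(1)=1$. Then, for any compact operator $\mathcal K$ on $\mathcal H$ and any fixed $T>0$, setting $\mathcal K_{\sigma(\varepsilon)}:=\Lambda_{\sigma(\varepsilon)}^{-1}\mathcal K$, one has $$\lim_{\varepsilon\to0}\left\|\frac1T\int_0^T\exp\Bigl(-i\frac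 t\varepsilon\mathcal B_{\sigma(\varepsilon)}\Bigr)\,\mathcal K_{\sigma(\varepsilon)}\,\Pi_{\mathrm{cont},\sigma(\varepsilon)}\,\exp\Bigl(i\frac t\varepsilon\mathcal B_{\sigma(\varepsilon)}\Bigr)dt\right\|_{\mathcal L(\sigma(\varepsilon))}=0 .$$
   Context: $\langle\cdot,\cdot\rangle_\eta=\mathcal S_\eta(\cdot,\cdot)$, and $\|\cdot\|_{\mathcal L(\eta)}$ is the operator norm on $\mathcal H$ induced by the norm of the scalar product $\mathcal S_\eta$. When no scalar product is specified (self-adjointness, boundedness, etc.), the reference scalar product $\mathcal S_0$ is meant. $\sigma_p$ denotes the point spectrum (set of eigenvalues). An automorphism of $\mathcal H$ is a bounded linear bijection with bounded inverse. The family $(\Lambda_\eta)_{\eta\in[0,1]}$ is called bounded-holomorphic (in the real sense, following Kato, Perturbation Theory for Linear Operators, Chapter VII) if near every $\eta_0\in[0,1]$ it is given by a power series in $\eta-\eta_0$ with coefficients in $\mathcal L(\mathcal H)$, convergent in operator norm. With these definitions each $\mathcal B_\eta$ is self-adjoint with respect to $\mathcal S_\eta$. *)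

theory Defs
  imports "HOL-Analysis.Analysis"
begin

section \<open>Complex Hilbert spaces\<close>

class scaleC = scaleR +
  fixes scaleC :: "complex \<Rightarrow> 'a \<Rightarrow> 'a" (infixr "*\<^sub>C" 75)
  assumes scaleR_scaleC: "r *\<^sub>R x = complex_of_real r *\<^sub>C x"

class complex_vector = scaleC + ab_group_add +
  assumes scaleC_add_right: "c *\<^sub>C (x + y) = c *\<^sub>C x + c *\<^sub>C y"
    and scaleC_add_left: "(c + d) *\<^sub>C x = c *\<^sub>C x + d *\<^sub>C x"
    and scaleC_scaleC: "c *\<^sub>C d *\<^sub>C x = (c * d) *\<^sub>C x"
    and scaleC_one: "1 *\<^sub>C x = x"

class complex_normed_vector = complex_vector + real_normed_vector +
  assumes norm_scaleC: "norm (c *\<^sub>C x) = cmod c * norm x"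

text \<open>The scalar product is linear in the second argument and antilinear in the first one.\<close>

class complex_inner = complex_normed_vector +
  fixes cinner :: "'a \<Rightarrow> 'a \<Rightarrow> complex"
  assumes cinner_commute: "cinner x y = cnj (cinner y x)"
    and cinner_add_right: "cinner x (y + z) = cinner x y + cinner x z"
    and cinner_scaleC_right: "cinner x (c *\<^sub>C y) = c * cinner x y"
    and cinner_ge_zero: "0 \<le> Re (cinner x x)"
    and norm_eq_sqrt_cinner: "norm x = sqrt (Re (cinner x x))"

class complex_hilbert = complex_inner + banach

section \<open>Bounded operators\<close>

lemma bounded_linear_scaleC:
  "bounded_linear (\<lambda>x :: 'a :: complex_normed_vector. c *\<^sub>C x)"
  by (rule bounded_linear_intro[where K = "cmod c"])
     (simp_all add: scaleC_add_right scaleR_scaleC scaleC_scaleC norm_scaleC mult.commute)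

instantiation blinfun :: (real_normed_vector, complex_normed_vector) complex_normed_vector
begin

lift_definition scaleC_blinfun :: "complex \<Rightarrow> 'a \<Rightarrow>\<^sub>L 'b \<Rightarrow> 'a \<Rightarrow>\<^sub>L 'b"
  is "\<lambda>c f x. c *\<^sub>C f x"
  by (rule bounded_linear_compose[OF bounded_linear_scaleC])

instance
proof
  fix r :: real and c d :: complex and A B :: "'a \<Rightarrow>\<^sub>L 'b"
  show "r *\<^sub>R A = complex_of_real r *\<^sub>C A"
    by transfer (simp add: scaleR_scaleC)
  show "c *\<^sub>C (A + B) = c *\<^sub>C A + c *\<^sub>C B"
    by transfer (simp add: scaleC_add_right)
  show "(c + d) *\<^sub>C A = c *\<^sub>C A + d *\<^sub>C A"
    by transfer (simp add: scaleC_add_left)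
  show "c *\<^sub>C d *\<^sub>C A = (c * d) *\<^sub>C A"
    by transfer (simp add: scaleC_scaleC)
  show "1 *\<^sub>C A = A"
    by transfer (simp add: scaleC_one)
  show "norm (c *\<^sub>C A) = cmod c * norm A"
  proof transfer
    fix c :: complex and f :: "'a \<Rightarrow> 'b"
    assume "bounded_linear f"
    have "onorm (\<lambda>x. c *\<^sub>C f x) = onorm (\<lambda>x. cmod c *\<^sub>R f x)"
      unfolding onorm_def by (simp add: norm_scaleC)
    also have "\<dots> = cmod c * onorm f"
      using onorm_scaleR[OF \<open>bounded_linear f\<close>, of "cmod c"] by simp
    finally show "onorm (\<lambda>x. c *\<^sub>C f x) = cmod c * onorm f" .
  qed
qed

end

text \<open>
  The type of \<^term>\<open>A :: 'a \<Rightarrow>\<^sub>L 'a\<close> only provides real-linear bounded operators; the space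
  of bounded complex-linear operators is the following (closed) subspace,
  with the norm inherited from the type.
\<close>

definition clinear_ops :: "('a :: complex_normed_vector \<Rightarrow>\<^sub>L 'a) set" where
  "clinear_ops = {A. \<forall>c x. blinfun_apply A (c *\<^sub>C x) = c *\<^sub>C blinfun_apply A x}"

definition selfadjoint :: "('a :: complex_inner \<Rightarrow>\<^sub>L 'a) \<Rightarrow> bool" where
  "selfadjoint A \<longleftrightarrow> A \<in> clinear_ops \<and> (\<forall>x y. cinner (A x) y = cinner x (A y))"

text \<open>The order of self-adjoint operators; their quadratic forms are real-valued.\<close>

definition selfadjoint_le :: "('a :: complex_inner \<Rightarrow>\<^sub>L 'a) \<Rightarrow> ('a \<Rightarrow>\<^sub>L 'a) \<Rightarrow> bool" where
  "selfadjoint_le A B \<longleftrightarrow> (\<forall>x. Re (cinner x (A x)) \<le> Re (cinner x (B x)))"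

definition automorphism :: "('a :: complex_normed_vector \<Rightarrow>\<^sub>L 'a) \<Rightarrow> bool" where
  "automorphism A \<longleftrightarrow>
     A \<in> clinear_ops \<and> bij (blinfun_apply A) \<and> bounded_linear (inv (blinfun_apply A))"

text \<open>Meaningful for automorphisms only, since \<^const>\<open>Blinfun\<close> is unspecified on unbounded maps.\<close>

definition inverse_op :: "('a :: real_normed_vector \<Rightarrow>\<^sub>L 'a) \<Rightarrow> 'a \<Rightarrow>\<^sub>L 'a" where
  "inverse_op A = Blinfun (inv (blinfun_apply A))"

definition compact_op :: "('a :: complex_normed_vector \<Rightarrow>\<^sub>L 'a) \<Rightarrow> bool" where
  "compact_op A \<longleftrightarrow>
     A \<in> clinear_ops \<and> (\<forall>S. bounded S \<longrightarrow> compact (closure (blinfun_apply A ` S)))"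

definition point_spectrum :: "('a :: complex_normed_vector \<Rightarrow>\<^sub>L 'a) \<Rightarrow> complex set" where
  "point_spectrum A = {c. \<exists>x. x \<noteq> 0 \<and> A x = c *\<^sub>C x}"

definition ker_op :: "('a :: real_normed_vector \<Rightarrow>\<^sub>L 'a) \<Rightarrow> 'a set" where
  "ker_op A = {x. A x = 0}"

definition power_op :: "('a :: real_normed_vector \<Rightarrow>\<^sub>L 'a) \<Rightarrow> nat \<Rightarrow> 'a \<Rightarrow>\<^sub>L 'a" where
  "power_op A n = ((\<lambda>B. A o\<^sub>L B) ^^ n) id_blinfun"

text \<open>
  The function \<^const>\<open>exp\<close> of the library is not available here, since
  the type of bounded operators is not an instance of the class of normed algebras.
\<close>

definition exp_op :: "('a :: real_normed_vector \<Rightarrow>\<^sub>L 'a) \<Rightarrow> 'a \<Rightarrow>\<^sub>L 'a" where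
  "exp_op A = (\<Sum>n. power_op A n /\<^sub>R fact n)"

text \<open>
  Near an end point of the unit interval the expansion is required on the part of the
  neighbourhood that lies in the interval.
\<close>

definition bounded_holomorphic_family ::
    "(real \<Rightarrow> 'a :: complex_normed_vector \<Rightarrow>\<^sub>L 'a) \<Rightarrow> bool" where
  "bounded_holomorphic_family L \<longleftrightarrow>
     (\<forall>\<eta>\<^sub>0\<in>{0..1}. \<exists>a r. (\<forall>n. a n \<in> clinear_ops) \<and> r > 0 \<and>
        (\<forall>\<eta>\<in>{0..1}. \<bar>\<eta> - \<eta>\<^sub>0\<bar> < r \<longrightarrow> (\<lambda>n. (\<eta> - \<eta>\<^sub>0) ^ n *\<^sub>R a n) sums L \<eta>))"

section \<open>Notions relative to a modified scalar product\<close>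

definition scalar_prod ::
    "('a :: complex_inner \<Rightarrow>\<^sub>L 'a) \<Rightarrow> 'a \<Rightarrow> 'a \<Rightarrow> complex" where
  "scalar_prod L x y = cinner x (L y)"

definition norm_wrt :: "('a \<Rightarrow> 'a \<Rightarrow> complex) \<Rightarrow> 'a \<Rightarrow> real" where
  "norm_wrt S x = sqrt (Re (S x x))"

text \<open>As in the definition of \<^const>\<open>onorm\<close>, the point 0 contributes 0 / 0 = 0.\<close>

definition opnorm_wrt ::
    "('a \<Rightarrow> 'a \<Rightarrow> complex) \<Rightarrow> ('a :: real_normed_vector \<Rightarrow>\<^sub>L 'a) \<Rightarrow> real" where
  "opnorm_wrt S A = (SUP x. norm_wrt S (A x) / norm_wrt S x)"

definition orth_compl_wrt :: "('a \<Rightarrow> 'a \<Rightarrow> complex) \<Rightarrow> 'a set \<Rightarrow> 'a set" where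
  "orth_compl_wrt S M = {y. \<forall>x\<in>M. S x y = 0}"

text \<open>
  Meaningful if \<^term>\<open>S\<close> is a scalar product with norm equivalent to the given one and
  \<^term>\<open>M\<close> is a closed complex subspace, so that the decomposition exists, is unique and
  depends boundedly on the vector.
\<close>

definition orth_proj_wrt ::
    "('a \<Rightarrow> 'a \<Rightarrow> complex) \<Rightarrow> 'a :: real_normed_vector set \<Rightarrow> 'a \<Rightarrow>\<^sub>L 'a" where
  "orth_proj_wrt S M = Blinfun (\<lambda>x. THE y. y \<in> M \<and> x - y \<in> orth_compl_wrt S M)"

end

theory Submission
  imports Defs
begin

text \<open>
  Since \<open>\<sigma>\<close> is continuous with \<open>\<sigma> 0 = 0\<close>, only the behaviour of the family near
  \<open>\<eta> = 0\<close> matters. The average of a conjugated commutator \<open>[B\<^sub>\<eta>, Y]\<close> is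
  \<open>O(\<epsilon>)\<close>, because the integrand is \<open>\<epsilon>\<close> times a derivative. Moreover
  \<open>H\<^sub>c\<^sub>o\<^sub>n\<^sub>t\<close> is the \<open>S\<^sub>0\<close>-orthogonal complement of \<open>Ker B\<^sub>0\<close>
  for every \<open>\<eta>\<close>, and the operators \<open>B\<^sub>\<eta>\<close>, \<open>K\<^sub>\<eta>\<close> and the projections
  converge in norm as \<open>\<eta> \<rightarrow> 0\<close>. So it suffices that \<open>K \<Pi>\<^sub>0\<close> is a norm limit of
  commutators \<open>[B\<^sub>0, Y]\<close>.

  To see this, replace \<open>K\<close> by a finite rank operator and minimise the Hilbert-Schmidt norm of
  \<open>K \<Pi>\<^sub>0 - [B\<^sub>0, Y]\<close> over the finite rank operators \<open>Y\<close> that vanish on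
  \<open>Ker B\<^sub>0\<close>. A minimising sequence converges to a compact operator \<open>R\<close> that commutes
  with \<open>B\<^sub>0\<close> and vanishes on \<open>Ker B\<^sub>0\<close>. If \<open>R\<close> were nonzero, then \<open>B\<^sub>0\<close>
  would have an eigenvector among the vectors at which \<open>R\<close> attains its norm; as \<open>0\<close> is
  the only eigenvalue, it would lie in \<open>Ker B\<^sub>0\<close>, where \<open>R\<close> vanishes.
\<close>

section \<open>Complex scalar products\<close>

lemma cinner_add_left: "cinner (x + y) z = cinner x z + cinner y z"
  using cinner_commute[of "x + y" z] cinner_commute[of x z] cinner_commute[of y z]
  by (simp add: cinner_add_right)

lemma cinner_scaleC_left: "cinner (c *\<^sub>C x) y = cnj c * cinner x y"
  using cinner_commute[of "c *\<^sub>C x" y] cinner_commute[of x y] by (simp add: cinner_scaleC_right)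

lemma cinner_scaleR_left: "cinner (r *\<^sub>R x) y = r *\<^sub>R cinner x y"
  by (simp add: scaleR_scaleC cinner_scaleC_left scaleR_conv_of_real)

lemma cinner_scaleR_right: "cinner x (r *\<^sub>R y) = r *\<^sub>R cinner x y"
  by (simp add: scaleR_scaleC cinner_scaleC_right scaleR_conv_of_real)

lemma Re_cinner_self: "Re (cinner x x) = (norm x)\<^sup>2"
  by (simp add: norm_eq_sqrt_cinner cinner_ge_zero)

lemma cinner_self: "cinner x x = of_real ((norm x)\<^sup>2)"
proof -
  have "Im (cinner x x) = - Im (cinner x x)"
    using arg_cong[OF cinner_commute[of x x], of Im] by simp
  then show ?thesis
    by (simp add: complex_eq_iff Re_cinner_self)
qed

lemma Re_cinner_commute: "Re (cinner x y) = Re (cinner y x)"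
  using arg_cong[OF cinner_commute[of x y], of Re] by simp

lemma norm_add_square:
  fixes x y :: "'a :: complex_inner"
  shows "(norm (x + y))\<^sup>2 = (norm x)\<^sup>2 + 2 * Re (cinner x y) + (norm y)\<^sup>2"
  using Re_cinner_commute[of y x]
  by (simp add: Re_cinner_self[symmetric] cinner_add_left cinner_add_right)

lemma square_le_of_nonneg_quadratic:
  fixes a b c :: real
  assumes "\<And>t. 0 \<le> a + 2 * t * b + t\<^sup>2 * c"
  shows "b\<^sup>2 \<le> a * c"
proof (cases "c = 0")
  case True
  have "b = 0"
  proof (rule ccontr)
    assume "b \<noteq> 0"
    then show False
      using assms[of "- (a + 1) / (2 * b)"] True by (simp add: field_simps)
  qed
  then show ?thesis using True by simp
next
  case False
  have "c > 0"
  proof (rule ccontr)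
    assume "\<not> c > 0"
    with False have c: "c < 0" by simp
    define t where "t = (\<bar>a\<bar> + 2 * \<bar>b\<bar> + 1) / \<bar>c\<bar> + 1"
    have t: "t \<ge> 1" by (simp add: t_def)
    have "t * \<bar>c\<bar> = \<bar>a\<bar> + 2 * \<bar>b\<bar> + 1 + \<bar>c\<bar>" using c by (simp add: t_def field_simps)
    then have tc: "t * c = - (\<bar>a\<bar> + 2 * \<bar>b\<bar> + 1 + \<bar>c\<bar>)" using c by simp
    have "a + 2 * t * b + t\<^sup>2 * c = a + t * (2 * b + t * c)" by (simp add: power2_eq_square algebra_simps)
    also have "\<dots> = a + t * (2 * b - (\<bar>a\<bar> + 2 * \<bar>b\<bar> + 1 + \<bar>c\<bar>))" by (simp add: tc)
    also have "\<dots> \<le> a + t * (- (\<bar>a\<bar> + 1))"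
      by (intro add_left_mono mult_left_mono) (use t in auto)
    also have "\<dots> \<le> a + 1 * (- (\<bar>a\<bar> + 1))"
      by (intro add_left_mono mult_right_mono_neg) (use t in auto)
    also have "\<dots> < 0" by simp
    finally show False using assms[of t] by simp
  qed
  then show ?thesis
    using assms[of "- b / c"] by (simp add: field_simps power2_eq_square)
qed

lemma Re_cinner_le: "\<bar>Re (cinner x y)\<bar> \<le> norm x * norm y"
proof -
  have "(Re (cinner x y))\<^sup>2 \<le> (norm x)\<^sup>2 * (norm y)\<^sup>2"
  proof (rule square_le_of_nonneg_quadratic)
    fix t :: real
    have "0 \<le> (norm (x + t *\<^sub>R y))\<^sup>2" by simp
    then show "0 \<le> (norm x)\<^sup>2 + 2 * t * Re (cinner x y) + t\<^sup>2 * (norm y)\<^sup>2"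
      by (simp add: norm_add_square cinner_scaleR_right power_mult_distrib)
  qed
  then show ?thesis
    using abs_le_square_iff[of "Re (cinner x y)" "norm x * norm y"]
    by (simp add: power_mult_distrib abs_mult)
qed

lemma cmod_cinner_le: "cmod (cinner x y) \<le> norm x * norm y"
proof -
  have "(cmod (cinner x y))\<^sup>2 = Re (cinner x (cnj (cinner x y) *\<^sub>C y))"
    using cmod_power2[of "cinner x y"] by (simp add: cinner_scaleC_right power2_eq_square)
  also have "\<dots> \<le> norm x * (cmod (cinner x y) * norm y)"
    using Re_cinner_le[of x "cnj (cinner x y) *\<^sub>C y"] by (simp add: norm_scaleC)
  finally have "cmod (cinner x y) * cmod (cinner x y) \<le> cmod (cinner x y) * (norm x * norm y)"
    by (simp add: power2_eq_square mult_ac)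
  then show ?thesis
    by (cases "cinner x y = 0") (simp_all add: mult_le_cancel_left_pos)
qed

lemma bounded_bilinear_cinner: "bounded_bilinear cinner"
proof
  show "\<exists>K. \<forall>a b :: 'a. norm (cinner a b) \<le> norm a * norm b * K"
    by (rule exI[of _ 1]) (simp add: cmod_cinner_le)
qed (simp_all add: cinner_add_left cinner_add_right cinner_scaleR_left cinner_scaleR_right)

interpretation cinner: bounded_bilinear cinner
  by (rule bounded_bilinear_cinner)

declare cinner.zero_left [simp] cinner.zero_right [simp]

lemma parallelogram:
  fixes x y :: "'a :: complex_inner"
  shows "(norm (x + y))\<^sup>2 + (norm (x - y))\<^sup>2 = 2 * (norm x)\<^sup>2 + 2 * (norm y)\<^sup>2"
  using norm_add_square[of x y] norm_add_square[of x "- y"] by (simp add: cinner.minus_right)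

lemma scaleC_minus_right: "c *\<^sub>C (- x :: 'a :: complex_normed_vector) = - (c *\<^sub>C x)"
  using bounded_linear.linear[OF bounded_linear_scaleC] by (rule linear_neg)

lemma scaleC_diff_right: "c *\<^sub>C (x - y :: 'a :: complex_normed_vector) = c *\<^sub>C x - c *\<^sub>C y"
  using bounded_linear.linear[OF bounded_linear_scaleC] by (rule linear_diff)

lemma scaleC_zero_right: "c *\<^sub>C (0 :: 'a :: complex_normed_vector) = 0"
  using bounded_linear.linear[OF bounded_linear_scaleC] by (rule linear_0)

lemma scaleC_zero_left: "0 *\<^sub>C x = (0 :: 'a :: complex_normed_vector)"
  using scaleR_scaleC[of 0 x] by simp

lemma scaleC_minus_left: "(- c) *\<^sub>C x = - (c *\<^sub>C (x :: 'a :: complex_normed_vector))"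
  using scaleC_add_left[of "- c" c x] by (simp add: scaleC_zero_left eq_neg_iff_add_eq_0)

lemma scaleC_diff_left: "(c - d) *\<^sub>C x = c *\<^sub>C x - d *\<^sub>C (x :: 'a :: complex_normed_vector)"
  using scaleC_add_left[of c "- d" x] by (simp add: scaleC_minus_left)

lemma scaleC_scaleR: "c *\<^sub>C r *\<^sub>R x = r *\<^sub>R c *\<^sub>C (x :: 'a :: complex_normed_vector)"
  by (simp add: scaleR_scaleC scaleC_scaleC mult.commute)

lemma cinner_eq_zeroI:
  assumes "\<And>c. Re (cinner (c *\<^sub>C x) y) = 0"
  shows "cinner x y = 0"
  using assms[of 1] assms[of \<i>] by (simp add: complex_eq_iff cinner_scaleC_left)

section \<open>Minimising sequences and orthogonal projections\<close>

lemma minimizing_sequence: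
  fixes C :: "'v :: banach set" and q :: "'v \<Rightarrow> real"
  assumes "C \<noteq> {}"
    and nonneg: "\<And>x. x \<in> C \<Longrightarrow> 0 \<le> q x"
    and mid: "\<And>x y. x \<in> C \<Longrightarrow> y \<in> C \<Longrightarrow> (1/2) *\<^sub>R (x + y) \<in> C"
    and par: "\<And>x y. x \<in> C \<Longrightarrow> y \<in> C \<Longrightarrow>
                (norm (x - y))\<^sup>2 + 4 * q ((1/2) *\<^sub>R (x + y)) \<le> 2 * q x + 2 * q y"
  obtains X r where "\<And>n. X n \<in> C" "X \<longlonglongrightarrow> r" "(\<lambda>n. q (X n)) \<longlonglongrightarrow> Inf (q ` C)"
proof -
  define d where "d = Inf (q ` C)"
  have bdd: "bdd_below (q ` C)" using nonneg by (auto intro!: bdd_belowI2)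
  have low: "d \<le> q x" if "x \<in> C" for x
    unfolding d_def using bdd that by (intro cInf_lower) auto
  have "\<exists>x\<in>C. q x < d + 1 / real (Suc n)" for n
    using cInf_lessD[of "q ` C" "d + 1 / real (Suc n)"] \<open>C \<noteq> {}\<close> unfolding d_def by force
  then obtain X where X: "\<And>n. X n \<in> C" "\<And>n. q (X n) < d + 1 / real (Suc n)" by metis
  have dist: "(norm (X m - X n))\<^sup>2 \<le> 2 / real (Suc m) + 2 / real (Suc n)" for m n
    using par[OF X(1) X(1), of m n] low[OF mid[OF X(1) X(1), of m n]] X(2)[of m] X(2)[of n] by simp
  have "Cauchy X"
  proof (rule CauchyI)
    fix e :: real assume "0 < e"
    then obtain N where N: "4 / e\<^sup>2 < real (Suc N)"
      by (meson reals_Archimedean2 less_trans of_nat_less_iff lessI)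
    have N': "4 / real (Suc N) < e\<^sup>2" using N \<open>0 < e\<close> by (simp add: field_simps)
    have "norm (X m - X n) < e" if "m \<ge> N" "n \<ge> N" for m n
    proof -
      have "2 / real (Suc m) \<le> 2 / real (Suc N)" "2 / real (Suc n) \<le> 2 / real (Suc N)"
        using that by (auto intro!: divide_left_mono)
      with dist[of m n] N' have "(norm (X m - X n))\<^sup>2 < e\<^sup>2" by simp
      then show ?thesis using \<open>0 < e\<close> by (simp add: power2_less_imp_less)
    qed
    then show "\<exists>M. \<forall>m\<ge>M. \<forall>n\<ge>M. norm (X m - X n) < e" by blast
  qed
  then obtain r where r: "X \<longlonglongrightarrow> r" by (auto simp: Cauchy_convergent_iff convergent_def)
  have "(\<lambda>n. q (X n)) \<longlonglongrightarrow> d"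
  proof (rule tendsto_sandwich[OF _ _ tendsto_const])
    show "(\<lambda>n. d + 1 / real (Suc n)) \<longlonglongrightarrow> d"
      using tendsto_add[OF tendsto_const LIMSEQ_Suc[OF lim_1_over_n], of d] by simp
  qed (use X low in \<open>auto intro!: always_eventually less_imp_le\<close>)
  then show thesis using that X(1) r unfolding d_def by blast
qed

lemma nonneg_quadratic_min_zero:
  fixes b c :: real
  assumes "\<And>t. 0 \<le> 2 * t * b + t\<^sup>2 * c"
  shows "b = 0"
  using square_le_of_nonneg_quadratic[of 0 b c] assms by simp

lemma orthogonal_decomposition:
  fixes X :: "'a :: complex_hilbert set"
  assumes "closed X" "subspace X" and scale: "\<And>c x. x \<in> X \<Longrightarrow> c *\<^sub>C x \<in> X"
  obtains y where "y \<in> X" "\<And>z. z \<in> X \<Longrightarrow> cinner z (x - y) = 0"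
proof -
  define C where "C = (\<lambda>y. x - y) ` X"
  define q where "q = (\<lambda>v :: 'a. (norm v)\<^sup>2)"
  have qn: "0 \<le> q v" for v by (simp add: q_def)
  have ne: "C \<noteq> {}" using subspace_0[OF assms(2)] by (auto simp: C_def)
  have mid: "(1/2) *\<^sub>R (u + v) \<in> C" if "u \<in> C" "v \<in> C" for u v
  proof -
    obtain y z where "y \<in> X" "z \<in> X" "u = x - y" "v = x - z" using \<open>u \<in> C\<close> \<open>v \<in> C\<close> by (auto simp: C_def)
    moreover have "(1/2) *\<^sub>R ((x - y) + (x - z)) = x - (1/2) *\<^sub>R (y + z)"
      by (simp add: algebra_simps flip: scaleR_add_left)
    ultimately show ?thesis
      unfolding C_def by (metis image_eqI subspace_add subspace_scale assms(2))
  qed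
  have par: "(norm (u - v))\<^sup>2 + 4 * q ((1/2) *\<^sub>R (u + v)) \<le> 2 * q u + 2 * q v" for u v
  proof -
    have "4 * q ((1/2) *\<^sub>R (u + v)) = (norm (u + v))\<^sup>2"
      unfolding q_def norm_scaleR by (simp add: power_mult_distrib power_divide)
    then show ?thesis
      using parallelogram[of u v] by (simp add: q_def)
  qed
  obtain Z r where Z: "\<And>n. Z n \<in> C" "Z \<longlonglongrightarrow> r" "(\<lambda>n. q (Z n)) \<longlonglongrightarrow> Inf (q ` C)"
    using minimizing_sequence[of C q, OF ne qn mid par] by blast
  have r: "x - r \<in> X"
  proof (rule closed_sequentially[OF assms(1)])
    show "(\<lambda>n. x - Z n) \<longlonglongrightarrow> x - r" by (intro tendsto_intros Z)
    show "x - Z n \<in> X" for n using Z(1)[of n] by (auto simp: C_def)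
  qed
  have qr: "q r = Inf (q ` C)"
    using Z(3) by (rule LIMSEQ_unique[rotated]) (unfold q_def, intro tendsto_intros Z)
  have *: "Re (cinner z r) = 0" if "z \<in> X" for z
  proof (rule nonneg_quadratic_min_zero)
    fix t :: real
    have "r + t *\<^sub>R z = x - ((x - r) - t *\<^sub>R z)" by simp
    then have "r + t *\<^sub>R z \<in> C"
      unfolding C_def using r that by (metis image_eqI subspace_diff subspace_scale assms(2))
    then have "q r \<le> q (r + t *\<^sub>R z)"
      unfolding qr by (intro cInf_lower bdd_belowI2[of _ 0]) (auto simp: q_def)
    then show "0 \<le> 2 * t * Re (cinner z r) + t\<^sup>2 * (norm z)\<^sup>2"
      by (simp add: q_def norm_add_square cinner_scaleR_right power_mult_distrib Re_cinner_commute[of z r])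
  qed
  have "cinner z r = 0" if "z \<in> X" for z
    using * scale[OF that] by (intro cinner_eq_zeroI) auto
  then show thesis using that[OF r] by simp
qed

section \<open>Operators\<close>

lemma clinear_opsD: "A \<in> clinear_ops \<Longrightarrow> A (c *\<^sub>C x) = c *\<^sub>C A x" for A :: "'a :: complex_normed_vector \<Rightarrow>\<^sub>L 'a"
  by (simp add: clinear_ops_def)

lemma selfadjoint_clinear: "selfadjoint A \<Longrightarrow> A \<in> clinear_ops"
  by (simp add: selfadjoint_def)

lemma selfadjointD: "selfadjoint A \<Longrightarrow> cinner (A x) y = cinner x (A y)"
  by (simp add: selfadjoint_def)

definition ker_perp :: "('a :: complex_inner \<Rightarrow>\<^sub>L 'a) \<Rightarrow> 'a set" where
  "ker_perp A = {y. \<forall>x. A x = 0 \<longrightarrow> cinner x y = 0}"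

lemma ker_perp_projection:
  fixes A :: "'a :: complex_hilbert \<Rightarrow>\<^sub>L 'a"
  assumes A: "A \<in> clinear_ops"
  obtains P :: "'a \<Rightarrow>\<^sub>L 'a" where "P \<in> clinear_ops"
    "\<And>x. P x \<in> ker_perp A" "\<And>x. A (x - P x) = 0" "\<And>x. norm (P x) \<le> norm x"
    "\<And>x. A x = 0 \<Longrightarrow> P x = 0" "\<And>x. x \<in> ker_perp A \<Longrightarrow> P x = x"
proof -
  define N where "N = {x. A x = 0}"
  have N: "closed N" "subspace N" "\<And>c x. x \<in> N \<Longrightarrow> c *\<^sub>C x \<in> N"
    using A unfolding N_def
    by (auto intro!: closed_Collect_eq continuous_intros
        simp: subspace_def blinfun.bilinear_simps clinear_opsD scaleC_zero_right)
  have "\<exists>y. A (x - y) = 0 \<and> y \<in> ker_perp A" for x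
  proof -
    obtain y where "y \<in> N" "\<And>z. z \<in> N \<Longrightarrow> cinner z (x - y) = 0"
      using orthogonal_decomposition[OF N] by metis
    then show ?thesis by (intro exI[of _ "x - y"]) (auto simp: N_def ker_perp_def)
  qed
  then obtain p where p: "\<And>x. A (x - p x) = 0" "\<And>x. p x \<in> ker_perp A" by metis
  have uniq: "y = z" if "A (x - y) = 0" "y \<in> ker_perp A" "A (x - z) = 0" "z \<in> ker_perp A" for x y z
  proof -
    have "A (y - z) = 0" using that by (simp add: blinfun.bilinear_simps)
    moreover have "y - z \<in> ker_perp A" using that by (simp add: ker_perp_def cinner.diff_right)
    ultimately have "cinner (y - z) (y - z) = 0" by (simp add: ker_perp_def)
    then show ?thesis by (simp add: cinner_self)
  qed
  have sc: "p (c *\<^sub>C x) = c *\<^sub>C p x" for c x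
  proof (rule uniq[OF p])
    show "A (c *\<^sub>C x - c *\<^sub>C p x) = 0"
      using p(1)[of x] A by (simp add: clinear_opsD scaleC_zero_right flip: scaleC_diff_right)
    show "c *\<^sub>C p x \<in> ker_perp A" using p(2)[of x] by (simp add: ker_perp_def cinner_scaleC_right)
  qed
  have ad: "p (x + y) = p x + p y" for x y
  proof (rule uniq[OF p])
    show "A (x + y - (p x + p y)) = 0"
      using p(1)[of x] p(1)[of y] by (simp add: blinfun.bilinear_simps)
    show "p x + p y \<in> ker_perp A" using p(2)[of x] p(2)[of y] by (simp add: ker_perp_def cinner_add_right)
  qed
  have nm: "norm (p x) \<le> norm x" for x
  proof -
    have "cinner (p x) (x - p x) = 0"
      using p unfolding ker_perp_def by (metis (mono_tags, lifting) cinner_commute complex_cnj_zero mem_Collect_eq)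
    then have "(norm x)\<^sup>2 = (norm (p x))\<^sup>2 + (norm (x - p x))\<^sup>2"
      using norm_add_square[of "p x" "x - p x"] by simp
    then show ?thesis by (simp add: power2_le_imp_le)
  qed
  have bl: "bounded_linear p"
    by (rule bounded_linear_intro[where K = 1]) (simp_all add: ad sc scaleR_scaleC nm)
  show thesis
  proof (rule that[of "Blinfun p"])
    show "Blinfun p x = 0" if "A x = 0" for x
      using that by (simp add: bounded_linear_Blinfun_apply bl, intro uniq[OF p, of x 0]) (simp_all add: ker_perp_def)
    show "Blinfun p x = x" if "x \<in> ker_perp A" for x
      using that by (simp add: bounded_linear_Blinfun_apply bl, intro uniq[OF p, of x x]) simp_all
  qed (simp_all add: bounded_linear_Blinfun_apply bl p nm sc clinear_ops_def)
qed

section \<open>Compact operators commuting with a self-adjoint operator without eigenvalues\<close>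

lemma almost_maximizing_subseq:
  fixes R :: "'a :: complex_hilbert \<Rightarrow>\<^sub>L 'a" and x :: "nat \<Rightarrow> 'a"
  assumes "R \<noteq> 0" and cpt: "compact (closure (R ` cball 0 1))"
    and x: "\<And>n. norm (x n) \<le> 1"
    and lim: "(\<lambda>n. (norm R)\<^sup>2 * (norm (x n))\<^sup>2 - (norm (R (x n)))\<^sup>2) \<longlonglongrightarrow> 0"
  obtains l s where "strict_mono s" "(x \<circ> s) \<longlonglongrightarrow> l"
proof -
  define p where "p y = (norm R)\<^sup>2 * (norm y)\<^sup>2 - (norm (R y))\<^sup>2" for y
  have p_nonneg: "0 \<le> p y" for y
    using power_mono[OF norm_blinfun[of R y], of 2] by (simp add: p_def power_mult_distrib)
  have par: "p (y - z) \<le> 2 * p y + 2 * p z" for y z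
  proof -
    have "p (y - z) + p (y + z) = 2 * p y + 2 * p z"
    proof -
      from parallelogram[of "R y" "R z"] arg_cong[OF parallelogram[of y z], of "\<lambda>a. (norm R)\<^sup>2 * a"]
      show ?thesis by (simp add: p_def blinfun.bilinear_simps distrib_left)
    qed
    then show ?thesis using p_nonneg[of "y + z"] by linarith
  qed
  have "R (x n) \<in> closure (R ` cball 0 1)" for n
    using x by (intro subsetD[OF closure_subset]) auto
  then obtain z s where s: "strict_mono s" "((\<lambda>n. R (x n)) \<circ> s) \<longlonglongrightarrow> z"
    using cpt unfolding compact_def by metis
  have r: "norm R > 0" using assms(1) by simp
  have "Cauchy (x \<circ> s)"
  proof (rule CauchyI)
    fix e :: real assume "0 < e"
    define e' where "e' = (norm R)\<^sup>2 * e\<^sup>2 / 8"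
    have e': "e' > 0" using r \<open>0 < e\<close> by (simp add: e'_def)
    have "Cauchy (\<lambda>n. R (x (s n)))" using s(2) by (auto simp: o_def intro: LIMSEQ_imp_Cauchy)
    then obtain M1 where M1: "\<And>m n. m \<ge> M1 \<Longrightarrow> n \<ge> M1 \<Longrightarrow> norm (R (x (s m)) - R (x (s n))) < sqrt e'"
      unfolding Cauchy_iff using e' by (metis real_sqrt_gt_zero)
    have "(\<lambda>n. p (x (s n))) \<longlonglongrightarrow> 0"
      using LIMSEQ_subseq_LIMSEQ[OF lim s(1)] by (simp add: o_def p_def)
    then obtain M2 where M2: "\<And>n. n \<ge> M2 \<Longrightarrow> p (x (s n)) < e'"
      using e' p_nonneg by (force simp: LIMSEQ_iff)
    have "norm (x (s m) - x (s n)) < e" if "m \<ge> max M1 M2" "n \<ge> max M1 M2" for m n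
    proof -
      have "(norm (R (x (s m)) - R (x (s n))))\<^sup>2 < (sqrt e')\<^sup>2"
        using M1[of m n] that by (intro power_strict_mono) auto
      then have "(norm (R (x (s m) - x (s n))))\<^sup>2 < e'"
        using e' by (simp add: blinfun.bilinear_simps)
      then have "(norm R)\<^sup>2 * (norm (x (s m) - x (s n)))\<^sup>2 < 5 * e'"
        using par[of "x (s m)" "x (s n)"] M2[of m] M2[of n] that by (simp add: p_def)
      also have "\<dots> \<le> (norm R)\<^sup>2 * e\<^sup>2" by (simp add: e'_def)
      finally have "(norm (x (s m) - x (s n)))\<^sup>2 < e\<^sup>2" using r by simp
      then show ?thesis using \<open>0 < e\<close> by (simp add: power2_less_imp_less)
    qed
    then show "\<exists>M. \<forall>m\<ge>M. \<forall>n\<ge>M. norm ((x \<circ> s) m - (x \<circ> s) n) < e" unfolding o_def by blast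
  qed
  then show thesis using that s(1) by (auto simp: Cauchy_convergent_iff convergent_def)
qed

text \<open>
  The vectors at which a nonzero compact operator attains its norm form a subspace with compact
  unit sphere, and this subspace is invariant under every self-adjoint operator that commutes with
  the compact one.
\<close>

lemma compact_commuting_eq_zero:
  fixes B R :: "'a :: complex_hilbert \<Rightarrow>\<^sub>L 'a"
  assumes B: "selfadjoint B" and spec: "point_spectrum B \<subseteq> {0}"
    and cpt: "compact (closure (R ` cball 0 1))"
    and comm: "\<And>x. R (B x) = B (R x)"
    and ker: "\<And>x. B x = 0 \<Longrightarrow> R x = 0"
  shows "R = 0"
proof (rule ccontr)
  assume R: "R \<noteq> 0"
  define s where "s x y = (norm R)\<^sup>2 * Re (cinner x y) - Re (cinner (R x) (R y))" for x y
  define N where "N = {x. s x x = 0}"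
  have sxx: "s x x = (norm R)\<^sup>2 * (norm x)\<^sup>2 - (norm (R x))\<^sup>2" for x
    by (simp add: s_def Re_cinner_self)
  have s_nonneg: "0 \<le> s x x" for x
    using power_mono[OF norm_blinfun[of R x], of 2] by (simp add: sxx power_mult_distrib)
  have s_exp: "s (x + t *\<^sub>R y) (x + t *\<^sub>R y) = s x x + 2 * t * s x y + t\<^sup>2 * s y y" for x y t
    by (simp add: s_def blinfun.bilinear_simps cinner.add_left cinner.add_right cinner_scaleR_left
        cinner_scaleR_right Re_cinner_commute[of y x] Re_cinner_commute[of "R y" "R x"]
        power2_eq_square algebra_simps)
  have N_iff: "x \<in> N \<longleftrightarrow> (\<forall>y. s x y = 0)" for x
  proof
    assume x: "x \<in> N"
    show "\<forall>y. s x y = 0"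
    proof
      fix y
      have "(s x y)\<^sup>2 \<le> s x x * s y y"
        by (rule square_le_of_nonneg_quadratic) (metis s_exp s_nonneg)
      then show "s x y = 0" using x by (simp add: N_def)
    qed
  qed (simp add: N_def)
  have NB: "B x \<in> N" if "x \<in> N" for x
  proof -
    have "s (B x) y = s x (B y)" for y
      by (simp add: s_def comm selfadjointD[OF B])
    then show ?thesis using that by (simp add: N_iff)
  qed
  have N_lin: "x + t *\<^sub>R y \<in> N" if "x \<in> N" "y \<in> N" for x y t
    using that s_exp[of x t y] N_iff[of x] by (simp add: N_def)
  define Q where "Q = N \<inter> sphere 0 1"
  have cont: "continuous_on UNIV (\<lambda>x. s x x)"
    unfolding sxx by (intro continuous_intros)
  have "closed N" unfolding N_def by (intro closed_Collect_eq cont continuous_intros)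
  then have "closed Q"
    unfolding Q_def sphere_def by (intro closed_Int closed_Collect_eq continuous_intros)
  have compact: "compact Q"
    unfolding compact_def
  proof (intro allI impI)
    fix x :: "nat \<Rightarrow> 'a" assume x: "\<forall>n. x n \<in> Q"
    have l0: "(\<lambda>n. (norm R)\<^sup>2 * (norm (x n))\<^sup>2 - (norm (R (x n)))\<^sup>2) \<longlonglongrightarrow> 0"
      unfolding sxx[symmetric] using x by (simp add: Q_def N_def)
    have nx: "norm (x n) \<le> 1" for n using x by (simp add: Q_def)
    then obtain l k where k: "strict_mono k" "(x \<circ> k) \<longlonglongrightarrow> l"
      using almost_maximizing_subseq[OF R cpt nx l0] by blast
    then show "\<exists>l\<in>Q. \<exists>r. strict_mono r \<and> (x \<circ> r) \<longlonglongrightarrow> l"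
      using closed_sequentially[OF \<open>closed Q\<close>, of "x \<circ> k" l] x by auto
  qed
  have "Q \<noteq> {}"
  proof -
    have "\<exists>x. norm x = 1 \<and> norm (R x) > norm R * (1 - 1 / real (Suc n))" for n
    proof (rule ccontr)
      assume *: "\<not> ?thesis"
      have "norm (R x) \<le> norm R * (1 - 1 / real (Suc n)) * norm x" for x
      proof (cases "x = 0")
        case False
        have "norm (R ((1 / norm x) *\<^sub>R x)) \<le> norm R * (1 - 1 / real (Suc n))"
          using * False by (auto simp: not_less)
        then show ?thesis using False by (simp add: blinfun.bilinear_simps field_simps)
      qed (simp add: blinfun.bilinear_simps)
      moreover have "0 \<le> norm R * (1 - 1 / real (Suc n))" by simp
      ultimately have "norm R \<le> norm R * (1 - 1 / real (Suc n))" by (rule norm_blinfun_bound[rotated])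
      then show False using R by (simp add: algebra_simps divide_le_0_iff)
    qed
    then obtain x where x: "\<And>n. norm (x n) = 1" "\<And>n. norm (R (x n)) > norm R * (1 - 1 / real (Suc n))"
      by metis
    have "(\<lambda>n. norm R * (1 - 1 / real (Suc n))) \<longlonglongrightarrow> norm R * (1 - 0)"
      by (intro tendsto_intros LIMSEQ_Suc[OF lim_1_over_n])
    then have "(\<lambda>n. norm R * (1 - 1 / real (Suc n))) \<longlonglongrightarrow> norm R" by simp
    then have lim: "(\<lambda>n. norm (R (x n))) \<longlonglongrightarrow> norm R"
    proof (rule tendsto_sandwich[OF _ _ _ tendsto_const, rotated 2])
      show "\<forall>\<^sub>F n in sequentially. norm (R (x n)) \<le> norm R"
        using norm_blinfun[of R] x(1) by (metis (no_types, lifting) always_eventually mult.right_neutral)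
    qed (use x(2) less_imp_le in \<open>auto intro!: always_eventually\<close>)
    then have "(\<lambda>n. (norm R)\<^sup>2 * (norm (x n))\<^sup>2 - (norm (R (x n)))\<^sup>2) \<longlonglongrightarrow> (norm R)\<^sup>2 - (norm R)\<^sup>2"
      unfolding x(1) by (intro tendsto_intros) (simp_all add: tendsto_intros)
    then have l0: "(\<lambda>n. (norm R)\<^sup>2 * (norm (x n))\<^sup>2 - (norm (R (x n)))\<^sup>2) \<longlonglongrightarrow> 0" by simp
    obtain l k where k: "strict_mono k" "(x \<circ> k) \<longlonglongrightarrow> l"
      using almost_maximizing_subseq[OF R cpt eq_refl[OF x(1)] l0] by blast
    have "(\<lambda>n. s (x (k n)) (x (k n))) \<longlonglongrightarrow> s l l"
      using k(2) cont by (auto simp: o_def continuous_on_eq_continuous_at intro: isCont_tendsto_compose)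
    moreover have "(\<lambda>n. s (x (k n)) (x (k n))) \<longlonglongrightarrow> 0"
      using LIMSEQ_subseq_LIMSEQ[OF l0 k(1)] by (simp add: o_def sxx)
    ultimately have "s l l = 0" by (rule LIMSEQ_unique)
    moreover have "norm l = 1"
      using tendsto_norm[OF k(2)] x(1) by (simp add: o_def LIMSEQ_const_iff)
    ultimately show ?thesis by (auto simp: Q_def N_def)
  qed
  moreover have "continuous_on Q (\<lambda>x. Re (cinner x (B x)))"
    by (intro continuous_intros cinner.continuous_on)
  ultimately obtain x where x: "x \<in> Q" "\<And>y. y \<in> Q \<Longrightarrow> Re (cinner y (B y)) \<le> Re (cinner x (B x))"
    using continuous_attains_sup[OF compact, of "\<lambda>x. Re (cinner x (B x))"] by blast
  define l where "l = Re (cinner x (B x))"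
  define p where "p y = l * (norm y)\<^sup>2 - Re (cinner y (B y))" for y
  have p_nonneg: "0 \<le> p y" if "y \<in> N" for y
  proof (cases "y = 0")
    case False
    have "0 + (1 / norm y) *\<^sub>R y \<in> N"
      using that by (intro N_lin) (simp_all add: N_def s_def)
    then have "(1 / norm y) *\<^sub>R y \<in> Q" using False by (simp add: Q_def)
    from x(2)[OF this] show ?thesis using False
      by (simp add: p_def l_def blinfun.bilinear_simps cinner_scaleR_left cinner_scaleR_right
          field_simps power2_eq_square)
  qed (simp add: p_def)
  have px: "p x = 0" using x(1) by (simp add: p_def l_def Q_def)
  have xN: "x \<in> N" using x(1) by (simp add: Q_def)
  define w where "w = l *\<^sub>R x - B x"
  have w: "w \<in> N" using N_lin[OF NB[OF xN] xN, of l] N_lin[OF _ NB[OF xN], of "l *\<^sub>R x" "-1"]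
      N_lin[OF _ xN, of 0 l] by (simp add: w_def N_def s_def)
  have "Re (cinner w w) = 0"
  proof (rule nonneg_quadratic_min_zero)
    fix t :: real
    have "p (x + t *\<^sub>R w) = p x + 2 * t * Re (cinner w w) + t\<^sup>2 * p w"
    proof -
      have "Re (cinner x (B w)) = Re (cinner (B x) w)" "Re (cinner w (B x)) = Re (cinner (B x) w)"
        by (simp_all add: selfadjointD[OF B] Re_cinner_commute[of w])
      moreover have "Re (cinner w w) = l * Re (cinner x w) - Re (cinner (B x) w)"
        by (subst w_def) (simp add: cinner.diff_left cinner_scaleR_left)
      then have "2 * t * Re (cinner w w) = 2 * t * (l * Re (cinner x w) - Re (cinner (B x) w))" by simp
      moreover have "(norm (x + t *\<^sub>R w))\<^sup>2 = (norm x)\<^sup>2 + 2 * t * Re (cinner x w) + t\<^sup>2 * (norm w)\<^sup>2"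
        by (simp add: norm_add_square cinner_scaleR_right power_mult_distrib)
      ultimately show ?thesis
        by (simp add: p_def blinfun.bilinear_simps cinner.add_left cinner.add_right cinner_scaleR_left
            cinner_scaleR_right power2_eq_square algebra_simps)
    qed
    then show "0 \<le> 2 * t * Re (cinner w w) + t\<^sup>2 * p w"
      using p_nonneg[OF N_lin[OF xN w, of t]] px by simp
  qed
  then have "B x = l *\<^sub>R x" by (simp add: Re_cinner_self w_def)
  moreover have "x \<noteq> 0" using x(1) by (auto simp: Q_def)
  ultimately have "of_real l \<in> point_spectrum B"
    by (auto simp: point_spectrum_def scaleR_scaleC)
  then have "l = 0" using spec by auto
  then have "R x = 0" using \<open>B x = l *\<^sub>R x\<close> ker by simp
  then show False using xN x(1) R by (simp add: N_def sxx Q_def)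
qed

section \<open>Maximal orthonormal sets\<close>

definition orthonormal :: "'a :: complex_inner set \<Rightarrow> bool" where
  "orthonormal E \<longleftrightarrow> (\<forall>e\<in>E. \<forall>f\<in>E. cinner e f = (if e = f then 1 else 0))"

definition maximal_orthonormal :: "'a :: complex_inner set \<Rightarrow> bool" where
  "maximal_orthonormal E \<longleftrightarrow> orthonormal E \<and> (\<forall>x. (\<forall>e\<in>E. cinner e x = 0) \<longrightarrow> x = 0)"

lemma exists_maximal_orthonormal:
  obtains E :: "'a :: complex_inner set" where "maximal_orthonormal E"
proof -
  have "\<exists>M\<in>Collect orthonormal. \<forall>X\<in>Collect orthonormal. M \<subseteq> X \<longrightarrow> X = (M :: 'a set)"
  proof (rule subset_Zorn')
    fix C :: "'a set set" assume C: "subset.chain (Collect orthonormal) C"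
    show "\<Union>C \<in> Collect orthonormal"
      unfolding orthonormal_def mem_Collect_eq
    proof (intro ballI)
      fix e f assume "e \<in> \<Union>C" "f \<in> \<Union>C"
      then obtain X Y where XY: "X \<in> C" "Y \<in> C" "e \<in> X" "f \<in> Y" by blast
      with C have "X \<subseteq> Y \<or> Y \<subseteq> X" "orthonormal X" "orthonormal Y" by (auto simp: subset_chain_def)
      with XY show "cinner e f = (if e = f then 1 else 0)"
        unfolding orthonormal_def by blast
    qed
  qed
  then obtain M :: "'a set" where M: "orthonormal M" "\<And>X. orthonormal X \<Longrightarrow> M \<subseteq> X \<Longrightarrow> X = M" by blast
  have "x = 0" if x: "\<forall>e\<in>M. cinner e x = 0" for x
  proof (rule ccontr)
    assume "x \<noteq> 0"
    define e where "e = (1 / norm x) *\<^sub>R x"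
    have ee: "cinner e e = 1" using \<open>x \<noteq> 0\<close> by (simp add: cinner_self e_def)
    have fe: "cinner f e = 0" "cinner e f = 0" if "f \<in> M" for f
      using x that cinner_commute[of x f]
      by (simp_all add: e_def cinner_scaleR_right cinner_scaleR_left)
    have "e \<notin> M" using fe ee by force
    moreover have "orthonormal (insert e M)"
      using M(1) ee fe unfolding orthonormal_def by (auto split: if_splits)
    ultimately show False using M(2)[of "insert e M"] by blast
  qed
  with M(1) show thesis by (intro that[of M]) (auto simp: maximal_orthonormal_def)
qed

lemma cinner_orthonormal_sum:
  assumes "orthonormal F" "finite F" "e \<in> F"
  shows "cinner e (\<Sum>f\<in>F. c f *\<^sub>C f) = c e"
proof -
  have "cinner e (\<Sum>f\<in>F. c f *\<^sub>C f) = (\<Sum>f\<in>F. if e = f then c f else 0)"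
    unfolding cinner.sum_right using assms(1,3)
    by (intro sum.cong) (auto simp: cinner_scaleC_right orthonormal_def)
  then show ?thesis using assms by simp
qed

lemma cinner_sum_left_orthonormal:
  "cinner (\<Sum>f\<in>F. c f *\<^sub>C f) x = (\<Sum>f\<in>F. cnj (c f) * cinner f x)"
  by (simp add: cinner.sum_left cinner_scaleC_left)

lemma cnj_mult_self: "cnj z * z = complex_of_real ((cmod z)\<^sup>2)"
  by (simp only: complex_norm_square mult.commute)

lemma norm_orthonormal_sum:
  assumes "orthonormal F" "finite F"
  shows "(norm (\<Sum>f\<in>F. c f *\<^sub>C f))\<^sup>2 = (\<Sum>f\<in>F. (cmod (c f))\<^sup>2)"
proof -
  have "complex_of_real ((norm (\<Sum>f\<in>F. c f *\<^sub>C f))\<^sup>2) = (\<Sum>f\<in>F. cnj (c f) * c f)"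
    unfolding cinner_self[symmetric] cinner_sum_left_orthonormal
    by (intro sum.cong refl) (simp only: cinner_orthonormal_sum[OF assms])
  also have "\<dots> = (\<Sum>f\<in>F. complex_of_real ((cmod (c f))\<^sup>2))"
    by (simp only: cnj_mult_self)
  finally show ?thesis by (simp only: of_real_sum[symmetric] of_real_eq_iff)
qed

lemma orthonormal_best_approximation:
  assumes "orthonormal F" "finite F"
  shows "norm (x - (\<Sum>f\<in>F. cinner f x *\<^sub>C f)) \<le> norm (x - (\<Sum>f\<in>F. c f *\<^sub>C f))"
proof -
  define u where "u = x - (\<Sum>f\<in>F. cinner f x *\<^sub>C f)"
  define v where "v = (\<Sum>f\<in>F. (cinner f x - c f) *\<^sub>C f)"
  have "x - (\<Sum>f\<in>F. c f *\<^sub>C f) = u + v"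
    by (simp add: u_def v_def scaleC_diff_left sum_subtractf)
  moreover have "cinner v u = 0"
    unfolding v_def cinner_sum_left_orthonormal
    by (intro sum.neutral) (use assms in \<open>auto simp: u_def cinner.diff_right cinner_orthonormal_sum\<close>)
  then have "Re (cinner u v) = 0" using Re_cinner_commute[of u v] by simp
  then have "(norm (u + v))\<^sup>2 = (norm u)\<^sup>2 + (norm v)\<^sup>2" by (simp add: norm_add_square)
  ultimately show ?thesis unfolding u_def[symmetric] by (simp add: power2_le_imp_le)
qed

lemma orthonormal_subset: "orthonormal E \<Longrightarrow> F \<subseteq> E \<Longrightarrow> orthonormal F"
  unfolding orthonormal_def by blast

lemma Fourier_expansion:
  fixes x :: "'a :: complex_hilbert"
  assumes E: "maximal_orthonormal E"
  shows "((\<lambda>e. cinner e x *\<^sub>C e) has_sum x) E"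
proof -
  have on: "orthonormal E" using E by (simp add: maximal_orthonormal_def)
  define V where "V = {\<Sum>f\<in>F. c f *\<^sub>C f | F c. finite F \<and> F \<subseteq> E \<and> (\<forall>f. f \<notin> F \<longrightarrow> c f = 0)}"
  have VI: "(\<Sum>f\<in>F. c f *\<^sub>C f) \<in> V" if "finite F" "F \<subseteq> E" "\<And>f. f \<notin> F \<Longrightarrow> c f = 0" for F c
    using that unfolding V_def by blast
  have extend: "(\<Sum>f\<in>F. c f *\<^sub>C f) = (\<Sum>f\<in>G. c f *\<^sub>C f)"
    if "finite G" "F \<subseteq> G" "\<forall>f. f \<notin> F \<longrightarrow> c f = 0" for F G :: "'a set" and c
    using that by (intro sum.mono_neutral_left) (auto simp: scaleC_zero_left)
  have V_add: "u + v \<in> V" if "u \<in> V" "v \<in> V" for u v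
  proof -
    obtain F c where F: "finite F" "F \<subseteq> E" "\<forall>f. f \<notin> F \<longrightarrow> c f = 0" "u = (\<Sum>f\<in>F. c f *\<^sub>C f)"
      using \<open>u \<in> V\<close> by (auto simp: V_def)
    obtain G d where G: "finite G" "G \<subseteq> E" "\<forall>f. f \<notin> G \<longrightarrow> d f = 0" "v = (\<Sum>f\<in>G. d f *\<^sub>C f)"
      using \<open>v \<in> V\<close> by (auto simp: V_def)
    have "u + v = (\<Sum>f\<in>F\<union>G. (c f + d f) *\<^sub>C f)"
      using extend[of "F \<union> G" F c] extend[of "F \<union> G" G d] F G
      by (simp add: scaleC_add_left sum.distrib)
    then show ?thesis using F G by (auto intro!: VI)
  qed
  have V_scale: "a *\<^sub>C v \<in> V" if "v \<in> V" for a v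
  proof -
    obtain F c where F: "finite F" "F \<subseteq> E" "\<forall>f. f \<notin> F \<longrightarrow> c f = 0" "v = (\<Sum>f\<in>F. c f *\<^sub>C f)"
      using \<open>v \<in> V\<close> by (auto simp: V_def)
    have "a *\<^sub>C v = (\<Sum>f\<in>F. (a * c f) *\<^sub>C f)"
      unfolding F(4) by (simp add: linear_sum[OF bounded_linear.linear[OF bounded_linear_scaleC]] scaleC_scaleC)
    then show ?thesis using F by (auto intro!: VI)
  qed
  have clV: "closed (closure V)" by simp
  have cl_scale: "a *\<^sub>C v \<in> closure V" if "v \<in> closure V" for a v
  proof -
    obtain w where w: "\<And>n. w n \<in> V" "w \<longlonglongrightarrow> v"
      using \<open>v \<in> closure V\<close> unfolding closure_sequential by blast
    have "(\<lambda>n. a *\<^sub>C w n) \<longlonglongrightarrow> a *\<^sub>C v"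
      by (rule bounded_linear.tendsto[OF bounded_linear_scaleC w(2)])
    then show ?thesis using V_scale[OF w(1)] unfolding closure_sequential
      by (intro exI[of _ "\<lambda>n. a *\<^sub>C w n"]) auto
  qed
  have "0 \<in> V" using VI[of "{}" "\<lambda>_. 0"] by simp
  have sub: "subspace (closure V)"
    unfolding subspace_def
  proof (intro conjI ballI allI)
    show "0 \<in> closure V" using \<open>0 \<in> V\<close> closure_subset by blast
    show "u + v \<in> closure V" if "u \<in> closure V" "v \<in> closure V" for u v
    proof -
      obtain w z where w: "\<And>n. w n \<in> V" "w \<longlonglongrightarrow> u" and z: "\<And>n. z n \<in> V" "z \<longlonglongrightarrow> v"
        using \<open>u \<in> closure V\<close> \<open>v \<in> closure V\<close> unfolding closure_sequential by blast
      show ?thesis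
        using V_add[OF w(1) z(1)] tendsto_add[OF w(2) z(2)] unfolding closure_sequential
        by (intro exI[of _ "\<lambda>n. w n + z n"]) auto
    qed
    show "r *\<^sub>R v \<in> closure V" if "v \<in> closure V" for r v
      using cl_scale[OF that] by (simp add: scaleR_scaleC)
  qed
  obtain y where y: "y \<in> closure V" "\<And>z. z \<in> closure V \<Longrightarrow> cinner z (x - y) = 0"
    using orthogonal_decomposition[OF clV sub cl_scale] by blast
  have "cinner e (x - y) = 0" if "e \<in> E" for e
  proof (rule y(2))
    have "e \<in> V" using VI[of "{e}" "\<lambda>f. if f = e then 1 else 0"] that by (simp add: scaleC_one)
    then show "e \<in> closure V" using closure_subset by blast
  qed
  then have "x - y = 0" using E unfolding maximal_orthonormal_def by blast
  with y have x: "x \<in> closure V" by simp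
  show ?thesis
    unfolding has_sum_def
  proof (rule tendstoI)
    fix \<epsilon> :: real assume "\<epsilon> > 0"
    then obtain v where v: "v \<in> V" "dist v x < \<epsilon>" using x closure_approachable by blast
    then obtain F c where F: "finite F" "F \<subseteq> E" "\<forall>f. f \<notin> F \<longrightarrow> c f = 0" "v = (\<Sum>f\<in>F. c f *\<^sub>C f)"
      by (auto simp: V_def)
    have "dist (\<Sum>f\<in>G. cinner f x *\<^sub>C f) x < \<epsilon>" if "finite G" "F \<subseteq> G" "G \<subseteq> E" for G
    proof -
      have "norm (x - (\<Sum>f\<in>G. cinner f x *\<^sub>C f)) \<le> norm (x - v)"
        unfolding F(4) extend[OF that(1,2) F(3)]
        using on that by (intro orthonormal_best_approximation) (auto intro: orthonormal_subset)
      then show ?thesis using v(2) by (simp add: dist_norm norm_minus_commute)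
    qed
    then show "\<forall>\<^sub>F G in finite_subsets_at_top E. dist (\<Sum>f\<in>G. cinner f x *\<^sub>C f) x < \<epsilon>"
      unfolding eventually_finite_subsets_at_top using F(1,2) by blast
  qed
qed

lemma functional_orthonormal_bound:
  fixes \<phi> :: "'a :: complex_inner \<Rightarrow> complex"
  assumes on: "orthonormal F" "finite F"
    and bl: "bounded_linear \<phi>" and hom: "\<And>c x. \<phi> (c *\<^sub>C x) = c * \<phi> x"
    and bound: "\<And>x. cmod (\<phi> x) \<le> C * norm x" and "C \<ge> 0"
  shows "(\<Sum>f\<in>F. (cmod (\<phi> f))\<^sup>2) \<le> C\<^sup>2"
proof -
  define s where "s = (\<Sum>f\<in>F. (cmod (\<phi> f))\<^sup>2)"
  define x where "x = (\<Sum>f\<in>F. cnj (\<phi> f) *\<^sub>C f)"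
  have s0: "s \<ge> 0" by (simp add: s_def sum_nonneg)
  have "\<phi> x = (\<Sum>f\<in>F. cnj (\<phi> f) * \<phi> f)"
    unfolding x_def by (simp add: linear_sum[OF bounded_linear.linear[OF bl]] hom)
  also have "\<dots> = (\<Sum>f\<in>F. complex_of_real ((cmod (\<phi> f))\<^sup>2))"
    by (simp only: cnj_mult_self)
  also have "\<dots> = complex_of_real s" by (simp add: s_def)
  finally have "cmod (\<phi> x) = s" using s0 by simp
  moreover have "(norm x)\<^sup>2 = s" unfolding x_def s_def norm_orthonormal_sum[OF on] by simp
  then have "norm x = sqrt s" by (intro real_sqrt_unique[symmetric]) simp_all
  ultimately have "s \<le> C * sqrt s" using bound[of x] by simp
  then have le: "sqrt s * sqrt s \<le> C * sqrt s"
    unfolding real_sqrt_mult_self using s0 by simp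
  have "sqrt s \<le> C"
  proof (cases "s = 0")
    case False
    with s0 have "0 < sqrt s" by simp
    with le show ?thesis by (rule mult_right_le_imp_le)
  qed (simp add: \<open>C \<ge> 0\<close>)
  then have "(sqrt s)\<^sup>2 \<le> C\<^sup>2" using s0 by (intro power_mono) simp_all
  then show ?thesis unfolding s_def[symmetric] using s0 by simp
qed

lemma Bessel_inequality:
  assumes "orthonormal F" "finite F"
  shows "(\<Sum>f\<in>F. (cmod (cinner f x))\<^sup>2) \<le> (norm x)\<^sup>2"
proof -
  have "(\<Sum>f\<in>F. (cmod (cinner x f))\<^sup>2) \<le> (norm x)\<^sup>2"
    using assms
    by (rule functional_orthonormal_bound)
       (simp_all add: cinner.bounded_linear_right cinner_scaleC_right cmod_cinner_le)
  then show ?thesis by (metis (no_types, lifting) cinner_commute complex_mod_cnj sum.cong)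
qed

section \<open>Rank one operators and compactness\<close>

definition rank_one :: "('a \<Rightarrow> complex) \<Rightarrow> 'a \<Rightarrow> 'a :: complex_inner \<Rightarrow>\<^sub>L 'a" where
  "rank_one \<phi> f = Blinfun (\<lambda>x. \<phi> x *\<^sub>C f)"

lemma bounded_linear_scaleC_left: "bounded_linear (\<lambda>c. c *\<^sub>C (f :: 'a :: complex_normed_vector))"
  by (rule bounded_linear_intro[where K = "norm f"])
     (simp_all add: scaleC_add_left norm_scaleC scaleR_scaleC scaleC_scaleC scaleR_conv_of_real)

lemma rank_one_apply: "bounded_linear \<phi> \<Longrightarrow> rank_one \<phi> f x = \<phi> x *\<^sub>C f"
  unfolding rank_one_def
  using bounded_linear_compose[OF bounded_linear_scaleC_left, of \<phi> f]
  by (simp add: bounded_linear_Blinfun_apply)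

definition precompact_op :: "('a :: real_normed_vector \<Rightarrow>\<^sub>L 'a) \<Rightarrow> bool" where
  "precompact_op A \<longleftrightarrow> compact (closure (A ` cball 0 1))"

lemma precompact_opI:
  fixes A :: "'a :: real_normed_vector \<Rightarrow>\<^sub>L 'a"
  assumes "compact C" "A ` cball 0 1 \<subseteq> C"
  shows "precompact_op A"
proof -
  have "closure (A ` cball 0 1) \<subseteq> C"
    by (intro closure_minimal assms compact_imp_closed)
  then show ?thesis
    using compact_Int_closed[OF assms(1) closed_closure] unfolding precompact_op_def by (metis inf.absorb2)
qed

lemma precompact_op_add:
  fixes A B :: "'a :: real_normed_vector \<Rightarrow>\<^sub>L 'a"
  assumes "precompact_op A" "precompact_op B"
  shows "precompact_op (A + B)"
proof (rule precompact_opI)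
  show "compact {x + y | x y. x \<in> closure (A ` cball 0 1) \<and> y \<in> closure (B ` cball 0 1)}"
    using assms by (intro compact_sums) (simp_all add: precompact_op_def)
  show "(A + B) ` cball 0 1 \<subseteq> {x + y | x y. x \<in> closure (A ` cball 0 1) \<and> y \<in> closure (B ` cball 0 1)}"
    using closure_subset[of "A ` cball 0 1"] closure_subset[of "B ` cball 0 1"]
    unfolding image_subset_iff plus_blinfun.rep_eq by blast
qed

lemma precompact_op_scaleR:
  fixes A :: "'a :: real_normed_vector \<Rightarrow>\<^sub>L 'a"
  assumes "precompact_op A"
  shows "precompact_op (r *\<^sub>R A)"
proof (rule precompact_opI)
  show "compact ((\<lambda>x. r *\<^sub>R x) ` closure (A ` cball 0 1))"
    using assms by (intro compact_scaling) (simp_all add: precompact_op_def)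
  show "(r *\<^sub>R A) ` cball 0 1 \<subseteq> (\<lambda>x. r *\<^sub>R x) ` closure (A ` cball 0 1)"
    using closure_subset[of "A ` cball 0 1"] unfolding image_subset_iff scaleR_blinfun.rep_eq by blast
qed

lemma precompact_op_rank_one:
  assumes "bounded_linear \<phi>"
  shows "precompact_op (rank_one \<phi> f)"
proof -
  obtain K where K: "\<And>x. cmod (\<phi> x) \<le> norm x * K" "K \<ge> 0" using bounded_linear.nonneg_bounded[OF assms] by auto
  show ?thesis
  proof (rule precompact_opI)
    show "compact ((\<lambda>c. c *\<^sub>C f) ` cball 0 K)"
      by (intro compact_continuous_image linear_continuous_on bounded_linear_scaleC_left compact_cball)
    have "cmod (\<phi> x) \<le> K" if "norm x \<le> 1" for x
      using K(1)[of x] mult_right_mono[OF that K(2)] by simp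
    then show "rank_one \<phi> f ` cball 0 1 \<subseteq> (\<lambda>c. c *\<^sub>C f) ` cball 0 K"
      by (auto simp: rank_one_apply[OF assms])
  qed
qed

lemma precompact_op_limit:
  fixes R :: "'a :: banach \<Rightarrow>\<^sub>L 'a"
  assumes A: "\<And>n :: nat. precompact_op (A n)" and lim: "A \<longlonglongrightarrow> R"
  shows "precompact_op R"
  unfolding precompact_op_def compact_eq_totally_bounded
proof (intro conjI allI impI)
  show "complete (closure (R ` cball 0 1))" by (simp add: complete_eq_closed)
  fix e :: real assume "0 < e"
  then have e3: "e / 3 > 0" by simp
  obtain n where n: "norm (A n - R) < e / 3"
    using lim e3 unfolding LIMSEQ_iff by blast
  obtain k where k: "finite k" "closure (A n ` cball 0 1) \<subseteq> (\<Union>x\<in>k. ball x (e/3))"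
    using A[of n] e3 unfolding precompact_op_def compact_eq_totally_bounded by blast
  have "closure (R ` cball 0 1) \<subseteq> (\<Union>x\<in>k. ball x e)"
  proof
    fix y assume "y \<in> closure (R ` cball 0 1)"
    then obtain w where "w \<in> R ` cball 0 1" "dist w y < e / 3"
      using e3 unfolding closure_approachable by blast
    then obtain x where x: "norm x \<le> 1" "dist (R x) y < e / 3" by auto
    have "A n x \<in> closure (A n ` cball 0 1)"
      using x(1) by (intro subsetD[OF closure_subset]) auto
    with k(2) obtain z where z: "z \<in> k" "dist z (A n x) < e / 3" by fastforce
    have "dist (A n x) (R x) \<le> norm (A n - R) * norm x"
      using norm_blinfun[of "A n - R" x] by (simp add: dist_norm blinfun.bilinear_simps)
    also have "\<dots> \<le> norm (A n - R)" using mult_left_mono[OF x(1) norm_ge_zero] by simp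
    finally have "dist z y < e"
      using z(2) x(2) n dist_triangle[of z y "A n x"] dist_triangle[of "A n x" y "R x"] by simp
    then show "y \<in> (\<Union>x\<in>k. ball x e)" using z(1) by auto
  qed
  then show "\<exists>k. finite k \<and> closure (R ` cball 0 1) \<subseteq> (\<Union>x\<in>k. ball x e)" using k(1) by blast
qed

section \<open>Hilbert-Schmidt operators\<close>

definition hilbert_schmidt :: "'a set \<Rightarrow> ('a :: complex_inner \<Rightarrow>\<^sub>L 'a) \<Rightarrow> bool" where
  "hilbert_schmidt E A \<longleftrightarrow> (\<lambda>e. (norm (A e))\<^sup>2) summable_on E"

definition hs_square :: "'a set \<Rightarrow> ('a :: complex_inner \<Rightarrow>\<^sub>L 'a) \<Rightarrow> real" where
  "hs_square E A = (\<Sum>\<^sub>\<infinity>e\<in>E. (norm (A e))\<^sup>2)"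

lemma hs_square_has_sum:
  "hilbert_schmidt E A \<Longrightarrow> ((\<lambda>e. (norm (A e))\<^sup>2) has_sum hs_square E A) E"
  by (simp add: hilbert_schmidt_def hs_square_def)

lemma hs_square_nonneg: "0 \<le> hs_square E A"
  unfolding hs_square_def by (rule infsum_nonneg) simp

lemma hilbert_schmidt_scaleR:
  assumes "hilbert_schmidt E A"
  shows "hilbert_schmidt E (r *\<^sub>R A)"
  using summable_on_cmult_right[OF assms[unfolded hilbert_schmidt_def], of "r\<^sup>2"]
  by (simp add: hilbert_schmidt_def blinfun.bilinear_simps power_mult_distrib)

lemma hilbert_schmidt_add:
  assumes "hilbert_schmidt E A" "hilbert_schmidt E B"
  shows "hilbert_schmidt E (A + B)"
  unfolding hilbert_schmidt_def
proof (rule summable_on_comparison_test)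
  show "(\<lambda>e. 2 * (norm (A e))\<^sup>2 + 2 * (norm (B e))\<^sup>2) summable_on E"
    using assms unfolding hilbert_schmidt_def by (intro summable_on_add summable_on_cmult_right)
  show "(norm ((A + B) e))\<^sup>2 \<le> 2 * (norm (A e))\<^sup>2 + 2 * (norm (B e))\<^sup>2" for e
    using parallelogram[of "A e" "B e"] zero_le_power2[of "norm (A e - B e)"]
    unfolding plus_blinfun.rep_eq by linarith
qed simp

lemma hilbert_schmidt_rank_one:
  assumes on: "orthonormal E"
    and bl: "bounded_linear \<phi>" and hom: "\<And>c x. \<phi> (c *\<^sub>C x) = c * \<phi> x"
  shows "hilbert_schmidt E (rank_one \<phi> f)"
proof -
  obtain C where C: "\<And>x. cmod (\<phi> x) \<le> norm x * C" "C \<ge> 0" using bounded_linear.nonneg_bounded[OF bl] by auto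
  have "(\<lambda>e. (cmod (\<phi> e))\<^sup>2) summable_on E"
  proof (rule nonneg_bdd_above_summable_on)
    show "bdd_above (sum (\<lambda>e. (cmod (\<phi> e))\<^sup>2) ` {F. F \<subseteq> E \<and> finite F})"
      using C on by (intro bdd_aboveI2[where M = "C\<^sup>2"] functional_orthonormal_bound bl hom)
        (auto simp: mult.commute intro: orthonormal_subset)
  qed simp
  from summable_on_cmult_right[OF this, of "(norm f)\<^sup>2"] show ?thesis
    by (simp add: hilbert_schmidt_def rank_one_apply bl norm_scaleC power_mult_distrib mult.commute)
qed

lemma norm_le_hs_square:
  fixes A :: "'a :: complex_hilbert \<Rightarrow>\<^sub>L 'a"
  assumes E: "maximal_orthonormal E" and A: "hilbert_schmidt E A" "A \<in> clinear_ops"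
  shows "(norm A)\<^sup>2 \<le> hs_square E A"
proof -
  define q where "q = sqrt (hs_square E A)"
  have q: "q \<ge> 0" by (simp add: q_def hs_square_nonneg)
  have on: "orthonormal E" using E by (simp add: maximal_orthonormal_def)
  have "norm (A x) \<le> q * norm x" for x
  proof -
    have "((\<lambda>e. A (cinner e x *\<^sub>C e)) has_sum A x) E"
      by (rule has_sum_bounded_linear[OF blinfun.bounded_linear_right Fourier_expansion[OF E]])
    then have "((\<lambda>F. norm (\<Sum>e\<in>F. A (cinner e x *\<^sub>C e))) \<longlongrightarrow> norm (A x)) (finite_subsets_at_top E)"
      unfolding has_sum_def by (rule tendsto_norm)
    then show ?thesis
    proof (rule tendsto_upperbound)
      show "\<forall>\<^sub>F F in finite_subsets_at_top E. norm (\<Sum>e\<in>F. A (cinner e x *\<^sub>C e)) \<le> q * norm x"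
      proof (rule eventually_finite_subsets_at_top_weakI)
        fix F assume F: "finite F" "F \<subseteq> E"
        have "norm (\<Sum>e\<in>F. A (cinner e x *\<^sub>C e)) \<le> (\<Sum>e\<in>F. norm (A e) * cmod (cinner e x))"
          by (rule order.trans[OF norm_sum]) (simp add: clinear_opsD[OF A(2)] norm_scaleC mult.commute)
        moreover have "(\<Sum>e\<in>F. norm (A e) * cmod (cinner e x))\<^sup>2 \<le> (q * norm x)\<^sup>2"
        proof -
          have "(\<Sum>e\<in>F. norm (A e) * cmod (cinner e x))\<^sup>2
              \<le> (\<Sum>e\<in>F. (norm (A e))\<^sup>2) * (\<Sum>e\<in>F. (cmod (cinner e x))\<^sup>2)"
            by (rule Cauchy_Schwarz_ineq_sum)
          also have "\<dots> \<le> hs_square E A * (norm x)\<^sup>2"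
            using F on A(1) unfolding hs_square_def hilbert_schmidt_def
            by (intro mult_mono finite_sum_le_infsum Bessel_inequality infsum_nonneg sum_nonneg)
               (auto intro: orthonormal_subset)
          finally show ?thesis by (simp add: q_def power_mult_distrib hs_square_nonneg)
        qed
        then have "(\<Sum>e\<in>F. norm (A e) * cmod (cinner e x)) \<le> q * norm x"
          by (rule power2_le_imp_le) (simp add: q)
        ultimately show "norm (\<Sum>e\<in>F. A (cinner e x *\<^sub>C e)) \<le> q * norm x" by simp
      qed
    qed simp
  qed
  then have "norm A \<le> q" using q by (rule norm_blinfun_bound[rotated])
  then have "(norm A)\<^sup>2 \<le> q\<^sup>2" by (rule power_mono) simp
  then show ?thesis by (simp add: q_def hs_square_nonneg)
qed

lemma hs_square_parallelogram:
  fixes A B :: "'a :: complex_hilbert \<Rightarrow>\<^sub>L 'a"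
  assumes E: "maximal_orthonormal E"
    and A: "hilbert_schmidt E A" "A \<in> clinear_ops" and B: "hilbert_schmidt E B" "B \<in> clinear_ops"
  shows "(norm (A - B))\<^sup>2 + 4 * hs_square E ((1/2) *\<^sub>R (A + B)) \<le> 2 * hs_square E A + 2 * hs_square E B"
proof -
  have d: "A - B = A + (-1) *\<^sub>R B" by simp
  have "hilbert_schmidt E (A - B)" unfolding d using A B by (intro hilbert_schmidt_add hilbert_schmidt_scaleR)
  have "A - B \<in> clinear_ops"
    using A B by (simp add: clinear_ops_def blinfun.bilinear_simps scaleC_diff_right)
  have half: "4 * (norm (((1/2) *\<^sub>R (A + B)) e))\<^sup>2 = (norm ((A + B) e))\<^sup>2" for e
    unfolding scaleR_blinfun.rep_eq norm_scaleR by (simp add: power_mult_distrib power_divide)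
  have "((\<lambda>e. (norm ((A - B) e))\<^sup>2 + 4 * (norm (((1/2) *\<^sub>R (A + B)) e))\<^sup>2) has_sum
      (hs_square E (A - B) + 4 * hs_square E ((1/2) *\<^sub>R (A + B)))) E"
    using A B \<open>hilbert_schmidt E (A - B)\<close>
    by (intro has_sum_add has_sum_cmult_right hs_square_has_sum hilbert_schmidt_scaleR hilbert_schmidt_add)
  then have "((\<lambda>e. 2 * (norm (A e))\<^sup>2 + 2 * (norm (B e))\<^sup>2) has_sum
      (hs_square E (A - B) + 4 * hs_square E ((1/2) *\<^sub>R (A + B)))) E"
    unfolding half plus_blinfun.rep_eq minus_blinfun.rep_eq
    using parallelogram[of "A _" "B _"] by (simp only: add.commute)
  moreover have "((\<lambda>e. 2 * (norm (A e))\<^sup>2 + 2 * (norm (B e))\<^sup>2) has_sum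
      (2 * hs_square E A + 2 * hs_square E B)) E"
    using A B by (intro has_sum_add has_sum_cmult_right hs_square_has_sum)
  ultimately have "hs_square E (A - B) + 4 * hs_square E ((1/2) *\<^sub>R (A + B)) = 2 * hs_square E A + 2 * hs_square E B"
    by (rule has_sum_unique)
  moreover have "(norm (A - B))\<^sup>2 \<le> hs_square E (A - B)"
    by (rule norm_le_hs_square) fact+
  ultimately show ?thesis by simp
qed

lemma hs_cinner_rank_one:
  fixes A :: "'a :: complex_hilbert \<Rightarrow>\<^sub>L 'a"
  assumes E: "maximal_orthonormal E" and A: "A \<in> clinear_ops"
  shows "((\<lambda>e. Re (cinner (A e) (rank_one (cinner g) f e))) has_sum Re (cinner (A g) f)) E"
proof -
  have "bounded_linear (\<lambda>y. Re (cinner (A y) f))"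
    by (intro bounded_linear_compose[OF bounded_linear_Re] bounded_linear_compose[OF cinner.bounded_linear_left]
        blinfun.bounded_linear_right)
  from has_sum_bounded_linear[OF this Fourier_expansion[OF E, of g]]
  have "((\<lambda>e. Re (cinner (A (cinner e g *\<^sub>C e)) f)) has_sum Re (cinner (A g) f)) E" .
  moreover have "cinner (A (cinner e g *\<^sub>C e)) f = cinner (A e) (rank_one (cinner g) f e)" for e
    using cinner_commute[of g e]
    by (simp add: clinear_opsD[OF A] rank_one_apply cinner.bounded_linear_right cinner_scaleC_left cinner_scaleC_right)
  ultimately show ?thesis by simp
qed

lemma hs_square_perturb:
  fixes A W :: "'a :: complex_hilbert \<Rightarrow>\<^sub>L 'a"
  assumes "hilbert_schmidt E A" "hilbert_schmidt E W"
    and h: "((\<lambda>e. Re (cinner (A e) (W e))) has_sum h) E"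
  shows "hs_square E (A + t *\<^sub>R W) = hs_square E A + 2 * t * h + t\<^sup>2 * hs_square E W"
proof -
  have "((\<lambda>e. (norm (A e))\<^sup>2 + 2 * t * Re (cinner (A e) (W e)) + t\<^sup>2 * (norm (W e))\<^sup>2) has_sum
      (hs_square E A + 2 * t * h + t\<^sup>2 * hs_square E W)) E"
    using assms by (intro has_sum_add has_sum_cmult_right hs_square_has_sum)
  moreover have "(norm (A e))\<^sup>2 + 2 * t * Re (cinner (A e) (W e)) + t\<^sup>2 * (norm (W e))\<^sup>2
      = (norm ((A + t *\<^sub>R W) e))\<^sup>2" for e
    by (simp add: blinfun.bilinear_simps norm_add_square cinner_scaleR_right power_mult_distrib)
  ultimately show ?thesis unfolding hs_square_def by (simp add: infsumI)
qed

section \<open>Approximation of compact operators by commutators\<close>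

definition commutator :: "('a :: real_normed_vector \<Rightarrow>\<^sub>L 'a) \<Rightarrow> ('a \<Rightarrow>\<^sub>L 'a) \<Rightarrow> 'a \<Rightarrow>\<^sub>L 'a" where
  "commutator A B = (A o\<^sub>L B) - (B o\<^sub>L A)"

lemma subspace_clinear_ops: "subspace clinear_ops"
  by (auto simp: subspace_def clinear_ops_def blinfun.bilinear_simps scaleC_add_right scaleC_zero_right
      scaleC_scaleR)

lemma rank_one_clinear:
  assumes "bounded_linear \<phi>" "\<And>c x. \<phi> (c *\<^sub>C x) = c * \<phi> x"
  shows "rank_one \<phi> f \<in> clinear_ops"
  using assms by (simp add: clinear_ops_def rank_one_apply scaleC_scaleC)

definition hs_vanishing :: "'a set \<Rightarrow> ('a :: complex_inner \<Rightarrow>\<^sub>L 'a) \<Rightarrow> ('a \<Rightarrow>\<^sub>L 'a) set" where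
  "hs_vanishing E B =
     {A. A \<in> clinear_ops \<and> hilbert_schmidt E A \<and> precompact_op A \<and> (\<forall>x. B x = 0 \<longrightarrow> A x = 0)}"

lemma subspace_hs_vanishing: "subspace (hs_vanishing E B)"
proof -
  have "hilbert_schmidt E (0 :: 'a \<Rightarrow>\<^sub>L 'a)" by (simp add: hilbert_schmidt_def)
  moreover have "precompact_op (0 :: 'a \<Rightarrow>\<^sub>L 'a)" by (rule precompact_opI[of "{0}"]) auto
  ultimately show ?thesis
    using subspace_clinear_ops
    by (auto simp: subspace_def hs_vanishing_def blinfun.bilinear_simps
        intro: hilbert_schmidt_add hilbert_schmidt_scaleR precompact_op_add precompact_op_scaleR)
qed

lemma rank_one_hs_vanishing:
  fixes B :: "'a :: complex_inner \<Rightarrow>\<^sub>L 'a"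
  assumes "orthonormal E" "bounded_linear \<phi>" "\<And>c x. \<phi> (c *\<^sub>C x) = c * \<phi> x"
    and "\<And>x. B x = 0 \<Longrightarrow> \<phi> x = 0"
  shows "rank_one \<phi> f \<in> hs_vanishing E B"
  using assms
  by (simp add: hs_vanishing_def rank_one_clinear hilbert_schmidt_rank_one precompact_op_rank_one
      rank_one_apply scaleC_zero_left)

lemma ker_perp_cinner_zero: "g \<in> ker_perp B \<Longrightarrow> B x = 0 \<Longrightarrow> cinner g x = 0"
  unfolding ker_perp_def using cinner_commute[of g x] by simp

lemma commutator_rank_one:
  assumes B: "selfadjoint B"
  shows "commutator B (rank_one (cinner g) f) = rank_one (cinner g) (B f) - rank_one (cinner (B g)) f"
  by (rule blinfun_eqI)
     (simp add: commutator_def blinfun.bilinear_simps rank_one_apply cinner.bounded_linear_right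
       clinear_opsD[OF selfadjoint_clinear[OF B]] selfadjointD[OF B])

lemma commutator_rank_one_hs_vanishing:
  assumes B: "selfadjoint B" and "orthonormal E" and g: "g \<in> ker_perp B"
  shows "commutator B (rank_one (cinner g) f) \<in> hs_vanishing E B"
  unfolding commutator_rank_one[OF B]
  using assms
  by (intro subspace_diff subspace_hs_vanishing rank_one_hs_vanishing)
     (auto simp: cinner.bounded_linear_right cinner_scaleC_right ker_perp_cinner_zero selfadjointD[OF B])

text \<open>
  A Hilbert-Schmidt norm minimising sequence in the affine space of the operators that differ from
  the given one by commutators converges to an operator which is orthogonal to the commutators,
  that is, which commutes with the self-adjoint operator.
\<close>

lemma hs_commutator_approximation:
  fixes A B :: "'a :: complex_hilbert \<Rightarrow>\<^sub>L 'a"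
  assumes B: "selfadjoint B" "point_spectrum B \<subseteq> {0}"
    and E: "maximal_orthonormal E" and A: "A \<in> hs_vanishing E B" and "\<delta> > 0"
  obtains Y where "Y \<in> clinear_ops" "norm (A - commutator B Y) < \<delta>"
proof -
  define \<W> where "\<W> = span {commutator B (rank_one (cinner g) f) | g f. g \<in> ker_perp B}"
  define C where "C = (\<lambda>W. A + W) ` \<W>"
  have on: "orthonormal E" using E by (simp add: maximal_orthonormal_def)
  have Bc: "B \<in> clinear_ops" by (rule selfadjoint_clinear[OF B(1)])
  have W1: "\<W> \<subseteq> hs_vanishing E B"
    unfolding \<W>_def by (intro span_minimal subspace_hs_vanishing) (auto intro: commutator_rank_one_hs_vanishing B on)
  have "\<W> \<subseteq> commutator B ` clinear_ops"
    unfolding \<W>_def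
  proof (rule span_minimal)
    show "{commutator B (rank_one (cinner g) f) |g f. g \<in> ker_perp B} \<subseteq> commutator B ` clinear_ops"
      by (auto intro!: imageI rank_one_clinear simp: cinner.bounded_linear_right cinner_scaleC_right)
    have "linear (commutator B)"
      by (rule linearI)
        (auto intro!: blinfun_eqI simp: commutator_def blinfun.bilinear_simps algebra_simps)
    then show "subspace (commutator B ` clinear_ops)"
      by (rule linear_subspace_image[OF _ subspace_clinear_ops])
  qed
  then have W2: "\<exists>Y\<in>clinear_ops. W = commutator B Y" if "W \<in> \<W>" for W using that by blast
  have sW: "subspace \<W>" by (simp add: \<W>_def)
  have C: "X \<in> hs_vanishing E B" if "X \<in> C" for X
    using that A W1 by (auto simp: C_def intro!: subspace_add[OF subspace_hs_vanishing])
  have add: "X + t *\<^sub>R W \<in> C" if "X \<in> C" "W \<in> \<W>" for X W t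
  proof -
    obtain V where "V \<in> \<W>" "X = A + V" using \<open>X \<in> C\<close> by (auto simp: C_def)
    then have "X + t *\<^sub>R W = A + (V + t *\<^sub>R W)" "V + t *\<^sub>R W \<in> \<W>"
      using \<open>W \<in> \<W>\<close> sW by (simp_all add: subspace_add subspace_scale)
    then show ?thesis unfolding C_def by blast
  qed
  have ne: "C \<noteq> {}" using subspace_0[OF sW] by (auto simp: C_def)
  have mid: "(1/2) *\<^sub>R (X + Z) \<in> C" if "X \<in> C" "Z \<in> C" for X Z
  proof -
    obtain V W where VW: "V \<in> \<W>" "X = A + V" "W \<in> \<W>" "Z = A + W"
      using \<open>X \<in> C\<close> \<open>Z \<in> C\<close> by (auto simp: C_def)
    have "(1/2) *\<^sub>R ((A + V) + (A + W)) = A + (1/2) *\<^sub>R (V + W)"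
      by (simp add: scaleR_add_right flip: scaleR_add_left)
    moreover have "(1/2) *\<^sub>R (V + W) \<in> \<W>" using VW sW by (simp add: subspace_add subspace_scale)
    ultimately show ?thesis unfolding VW C_def by blast
  qed
  have par: "(norm (X - Z))\<^sup>2 + 4 * hs_square E ((1/2) *\<^sub>R (X + Z)) \<le> 2 * hs_square E X + 2 * hs_square E Z"
    if "X \<in> C" "Z \<in> C" for X Z
    using C[OF that(1)] C[OF that(2)] by (intro hs_square_parallelogram E) (auto simp: hs_vanishing_def)
  obtain X R where X: "\<And>n. X n \<in> C" "X \<longlonglongrightarrow> R" "(\<lambda>n. hs_square E (X n)) \<longlonglongrightarrow> Inf (hs_square E ` C)"
    using minimizing_sequence[of C "hs_square E", OF ne hs_square_nonneg mid par] by blast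
  have Xx: "(\<lambda>n. X n x) \<longlonglongrightarrow> R x" for x
    by (intro blinfun.tendsto X tendsto_const)
  have "R = 0"
  proof (rule compact_commuting_eq_zero[OF B])
    show "compact (closure (R ` cball 0 1))"
      using precompact_op_limit[OF _ X(2)] C[OF X(1)] by (simp add: hs_vanishing_def precompact_op_def)
    show ker: "R x = 0" if "B x = 0" for x
    proof (rule LIMSEQ_unique[OF Xx])
      show "(\<lambda>n. X n x) \<longlonglongrightarrow> 0" using C[OF X(1)] that by (simp add: hs_vanishing_def)
    qed
    have perp: "R (B g) = B (R g)" if g: "g \<in> ker_perp B" for g
    proof -
      define f where "f = B (R g) - R (B g)"
      define W where "W = commutator B (rank_one (cinner g) f)"
      have W: "W \<in> \<W>" unfolding \<W>_def W_def using g by (blast intro: span_base)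
      define h where "h n = Re (cinner (X n g) (B f)) - Re (cinner (X n (B g)) f)" for n
      have h: "((\<lambda>e. Re (cinner (X n e) (W e))) has_sum h n) E" for n
      proof -
        have "X n \<in> clinear_ops" using C[OF X(1)] by (simp add: hs_vanishing_def)
        note 1 = hs_cinner_rank_one[OF E this, of g "B f"] and 2 = hs_cinner_rank_one[OF E this, of "B g" f]
        show ?thesis
          using has_sum_add[OF 1 has_sum_cmult_right[OF 2, of "-1"]]
          by (simp add: W_def h_def commutator_rank_one[OF B(1)] blinfun.bilinear_simps cinner.diff_right)
      qed
      have "Re (cinner (R g) (B f)) - Re (cinner (R (B g)) f) = 0"
      proof (rule nonneg_quadratic_min_zero)
        fix t :: real
        have "Inf (hs_square E ` C) \<le> hs_square E (X n) + 2 * t * h n + t\<^sup>2 * hs_square E W" for n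
        proof -
          have "Inf (hs_square E ` C) \<le> hs_square E (X n + t *\<^sub>R W)"
            by (intro cInf_lower imageI add X W bdd_belowI2[of _ 0] hs_square_nonneg)
          also have "\<dots> = hs_square E (X n) + 2 * t * h n + t\<^sup>2 * hs_square E W"
            using C[OF X(1)[of n]] W W1 by (intro hs_square_perturb h) (auto simp: hs_vanishing_def)
          finally show ?thesis .
        qed
        moreover have "(\<lambda>n. hs_square E (X n) + 2 * t * h n + t\<^sup>2 * hs_square E W) \<longlonglongrightarrow>
            Inf (hs_square E ` C) + 2 * t * (Re (cinner (R g) (B f)) - Re (cinner (R (B g)) f)) + t\<^sup>2 * hs_square E W"
          unfolding h_def by (intro tendsto_intros X tendsto_Re cinner.tendsto Xx)
        ultimately have "Inf (hs_square E ` C) \<le> Inf (hs_square E ` C)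
            + 2 * t * (Re (cinner (R g) (B f)) - Re (cinner (R (B g)) f)) + t\<^sup>2 * hs_square E W"
          by (intro LIMSEQ_le_const) auto
        then show "0 \<le> 2 * t * (Re (cinner (R g) (B f)) - Re (cinner (R (B g)) f)) + t\<^sup>2 * hs_square E W"
          by simp
      qed
      then have "Re (cinner (B (R g) - R (B g)) f) = 0"
        by (simp add: cinner.diff_left selfadjointD[OF B(1)])
      then have "f = 0" unfolding f_def by (simp add: Re_cinner_self)
      then show ?thesis by (simp add: f_def)
    qed
    show "R (B x) = B (R x)" for x
    proof -
      obtain P :: "'a \<Rightarrow>\<^sub>L 'a" where "P \<in> clinear_ops"
        and P: "\<And>x. P x \<in> ker_perp B" "\<And>x. B (x - P x) = 0" and "\<And>x. norm (P x) \<le> norm x"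
          "\<And>x. B x = 0 \<Longrightarrow> P x = 0" "\<And>x. x \<in> ker_perp B \<Longrightarrow> P x = x"
        by (rule ker_perp_projection[OF Bc], rule that)
      have "R (x - P x) = 0" using P(2) by (rule ker)
      then have "R x = R (P x)" by (simp add: blinfun.diff_right)
      moreover have "B x = B (P x)" using P(2)[of x] by (simp add: blinfun.diff_right)
      ultimately show ?thesis using perp[OF P(1)[of x]] by simp
    qed
  qed
  obtain n where "norm (X n - R) < \<delta>"
    using X(2) \<open>\<delta> > 0\<close> unfolding LIMSEQ_iff by blast
  with \<open>R = 0\<close> have n: "norm (X n) < \<delta>" by simp
  obtain W where W: "W \<in> \<W>" "X n = A + W" using X(1)[of n] by (auto simp: C_def)
  obtain Y where Y: "Y \<in> clinear_ops" "- W = commutator B Y"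
    using W2[OF subspace_neg[OF sW W(1)]] by blast
  show thesis
  proof (rule that[OF Y(1)])
    show "norm (A - commutator B Y) < \<delta>" using n by (simp add: W(2) Y(2)[symmetric])
  qed
qed

lemma norm_blinfun_le_of_cball:
  fixes A :: "'a :: real_normed_vector \<Rightarrow>\<^sub>L 'b :: real_normed_vector"
  assumes "\<And>x. norm x \<le> 1 \<Longrightarrow> norm (A x) \<le> C"
  shows "norm A \<le> C"
proof (rule norm_blinfun_bound)
  show "0 \<le> C" using assms[of 0] by simp
  show "norm (A x) \<le> C * norm x" for x
  proof (cases "x = 0")
    case False
    then show ?thesis
      using assms[of "(1 / norm x) *\<^sub>R x"] by (simp add: blinfun.bilinear_simps field_simps)
  qed simp
qed

lemma compact_finite_rank_approximation:
  fixes K :: "'a :: complex_hilbert \<Rightarrow>\<^sub>L 'a"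
  assumes E: "maximal_orthonormal E" and K: "precompact_op K" and "\<delta> > 0"
  obtains F where "finite F" "F \<subseteq> E"
    "\<And>x. norm x \<le> 1 \<Longrightarrow> norm (K x - (\<Sum>e\<in>F. cinner e (K x) *\<^sub>C e)) \<le> \<delta>"
proof -
  have d2: "\<delta> / 2 > 0" using \<open>\<delta> > 0\<close> by simp
  obtain k where k: "finite k" "closure (K ` cball 0 1) \<subseteq> (\<Union>z\<in>k. ball z (\<delta>/2))"
    using K d2 unfolding precompact_op_def compact_eq_totally_bounded by blast
  have "\<exists>F. finite F \<and> F \<subseteq> E \<and> (\<forall>G. finite G \<and> F \<subseteq> G \<and> G \<subseteq> E \<longrightarrow>
      dist (\<Sum>e\<in>G. cinner e z *\<^sub>C e) z < \<delta> / 2)" for z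
    using tendstoD[OF Fourier_expansion[OF E, of z, unfolded has_sum_def] d2]
    unfolding eventually_finite_subsets_at_top .
  then obtain \<F> where \<F>: "\<And>z. finite (\<F> z)" "\<And>z. \<F> z \<subseteq> E"
    "\<And>z G. finite G \<Longrightarrow> \<F> z \<subseteq> G \<Longrightarrow> G \<subseteq> E \<Longrightarrow> dist (\<Sum>e\<in>G. cinner e z *\<^sub>C e) z < \<delta> / 2"
    by metis
  define F where "F = (\<Union>z\<in>k. \<F> z)"
  have F: "finite F" "F \<subseteq> E" using k(1) \<F> by (auto simp: F_def)
  then have on: "orthonormal F" using E orthonormal_subset unfolding maximal_orthonormal_def by blast
  have "norm (K x - (\<Sum>e\<in>F. cinner e (K x) *\<^sub>C e)) \<le> \<delta>" if "norm x \<le> 1" for x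
  proof -
    have "K x \<in> closure (K ` cball 0 1)" using that by (intro subsetD[OF closure_subset]) auto
    then obtain z where z: "z \<in> k" "dist z (K x) < \<delta> / 2" using k(2) by auto
    have "norm (K x - (\<Sum>e\<in>F. cinner e (K x) *\<^sub>C e)) \<le> norm (K x - (\<Sum>e\<in>F. cinner e z *\<^sub>C e))"
      by (rule orthonormal_best_approximation[OF on F(1)])
    also have "\<dots> \<le> dist (K x) z + dist (\<Sum>e\<in>F. cinner e z *\<^sub>C e) z"
      unfolding dist_norm[symmetric] by (rule dist_triangle2)
    also have "\<dots> \<le> \<delta>"
    proof -
      have "\<F> z \<subseteq> F" using z(1) by (auto simp: F_def)
      from \<F>(3)[OF F(1) this F(2)] show ?thesis using z(2) by (simp add: dist_commute)
    qed
    finally show ?thesis .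
  qed
  then show thesis using that F by blast
qed

lemma compact_commutator_approximation:
  fixes B K P :: "'a :: complex_hilbert \<Rightarrow>\<^sub>L 'a"
  assumes B: "selfadjoint B" "point_spectrum B \<subseteq> {0}"
    and K: "K \<in> clinear_ops" "precompact_op K"
    and P: "P \<in> clinear_ops" "norm P \<le> 1" "\<And>x. B x = 0 \<Longrightarrow> P x = 0"
    and "\<delta> > 0"
  obtains Y where "Y \<in> clinear_ops" "norm ((K o\<^sub>L P) - commutator B Y) < \<delta>"
proof -
  obtain E :: "'a set" where E: "maximal_orthonormal E" by (rule exists_maximal_orthonormal)
  then have on: "orthonormal E" by (simp add: maximal_orthonormal_def)
  have d2: "\<delta> / 2 > 0" using \<open>\<delta> > 0\<close> by simp
  obtain F where F: "finite F" "F \<subseteq> E"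
    "\<And>x. norm x \<le> 1 \<Longrightarrow> norm (K x - (\<Sum>e\<in>F. cinner e (K x) *\<^sub>C e)) \<le> \<delta> / 2"
    using compact_finite_rank_approximation[OF E K(2) d2] by blast
  define A where "A = (\<Sum>e\<in>F. rank_one (\<lambda>x. cinner e (K (P x))) e)"
  have bl: "bounded_linear (\<lambda>x. cinner e (K (P x)))" for e
    by (intro bounded_linear_compose[OF cinner.bounded_linear_right]
        bounded_linear_compose[OF blinfun.bounded_linear_right] blinfun.bounded_linear_right)
  have "A \<in> hs_vanishing E B"
    unfolding A_def
    by (intro subspace_sum subspace_hs_vanishing rank_one_hs_vanishing on bl)
       (simp_all add: clinear_opsD K(1) P(1,3) cinner_scaleC_right)
  from hs_commutator_approximation[OF B E this d2]
  obtain Y where Y: "Y \<in> clinear_ops" "norm (A - commutator B Y) < \<delta> / 2" .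
  have Ax: "A x = (\<Sum>e\<in>F. cinner e (K (P x)) *\<^sub>C e)" for x
    unfolding A_def by (simp add: blinfun.sum_left rank_one_apply[OF bl])
  have "norm ((K o\<^sub>L P) - A) \<le> \<delta> / 2"
  proof (rule norm_blinfun_le_of_cball)
    fix x :: 'a assume "norm x \<le> 1"
    then have "norm P * norm x \<le> 1" using P(2) by (intro mult_le_one) simp_all
    then have "norm (P x) \<le> 1" using norm_blinfun[of P x] by simp
    from F(3)[OF this] show "norm (((K o\<^sub>L P) - A) x) \<le> \<delta> / 2"
      unfolding minus_blinfun.rep_eq by (simp add: Ax)
  qed
  then have "norm (((K o\<^sub>L P) - A) + (A - commutator B Y)) < \<delta>"
    using norm_triangle_ineq[of "(K o\<^sub>L P) - A" "A - commutator B Y"] Y(2) by simp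
  then show thesis using that[OF Y(1)] by simp
qed

section \<open>The exponential series\<close>

lemma power_op_0 [simp]: "power_op A 0 = id_blinfun"
  by (simp add: power_op_def)

lemma power_op_Suc: "power_op A (Suc n) = A o\<^sub>L power_op A n"
  by (simp add: power_op_def)

lemma norm_power_op: "norm (power_op A n) \<le> norm A ^ n"
proof (induction n)
  case (Suc n)
  have "norm (power_op A (Suc n)) \<le> norm A * norm (power_op A n)"
    unfolding power_op_Suc by (rule norm_blinfun_compose)
  also have "\<dots> \<le> norm A * norm A ^ n" using Suc by (rule mult_left_mono) simp
  finally show ?case by simp
qed (simp add: norm_blinfun_id_le)

lemma power_op_scaleR: "power_op (r *\<^sub>R A) n = r ^ n *\<^sub>R power_op A n"
  by (induction n)
     (auto intro!: blinfun_eqI simp: power_op_Suc blinfun.bilinear_simps)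

lemma blinfun_compose_assoc: "(A o\<^sub>L B) o\<^sub>L C = A o\<^sub>L (B o\<^sub>L C)"
  by (auto intro: blinfun_eqI)

lemma power_op_commute: "A o\<^sub>L power_op A n = power_op A n o\<^sub>L A"
proof (induction n)
  case (Suc n)
  then show ?case unfolding power_op_Suc by (metis blinfun_compose_assoc)
qed (auto intro: blinfun_eqI)

lemma exp_op_sums:
  fixes A :: "'a :: banach \<Rightarrow>\<^sub>L 'a"
  shows "(\<lambda>n. power_op A n /\<^sub>R fact n) sums exp_op A"
  unfolding exp_op_def
proof (rule summable_sums[OF summable_comparison_test'])
  show "summable (\<lambda>n. inverse (fact n) * norm A ^ n)" by (rule summable_exp)
  show "norm (power_op A n /\<^sub>R fact n) \<le> inverse (fact n) * norm A ^ n" if "n \<ge> 0" for n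
    by (simp add: norm_power_op mult_left_mono)
qed

lemma exp_op_zero: "exp_op 0 = (id_blinfun :: 'a :: banach \<Rightarrow>\<^sub>L 'a)"
proof -
  have "power_op 0 n /\<^sub>R fact n = (if n = 0 then id_blinfun else 0 :: 'a \<Rightarrow>\<^sub>L 'a)" for n
    by (cases n) (auto intro: blinfun_eqI simp: power_op_Suc)
  then have "(\<lambda>n. if n = 0 then id_blinfun else 0) sums exp_op (0 :: 'a \<Rightarrow>\<^sub>L 'a)"
    using exp_op_sums[of "0 :: 'a \<Rightarrow>\<^sub>L 'a"] by simp
  then show ?thesis using sums_single[of 0 "\<lambda>_. id_blinfun"] sums_unique2 by blast
qed

lemmas bounded_linear_blinfun_compose_left = bounded_bilinear.bounded_linear_left[OF bounded_bilinear_blinfun_compose]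
lemmas bounded_linear_blinfun_compose_right = bounded_bilinear.bounded_linear_right[OF bounded_bilinear_blinfun_compose]

lemma exp_op_commute:
  fixes A :: "'a :: banach \<Rightarrow>\<^sub>L 'a"
  shows "A o\<^sub>L exp_op A = exp_op A o\<^sub>L A"
proof -
  have "(\<lambda>n. A o\<^sub>L (power_op A n /\<^sub>R fact n)) sums (A o\<^sub>L exp_op A)"
    by (rule bounded_linear.sums[OF bounded_linear_blinfun_compose_right exp_op_sums])
  moreover have "(\<lambda>n. (power_op A n /\<^sub>R fact n) o\<^sub>L A) sums (exp_op A o\<^sub>L A)"
    by (rule bounded_linear.sums[OF bounded_linear_blinfun_compose_left exp_op_sums])
  moreover have "A o\<^sub>L (power_op A n /\<^sub>R fact n) = (power_op A n /\<^sub>R fact n) o\<^sub>L A" for n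
    using power_op_commute[of A n]
    by (simp add: linear_cmul[OF bounded_linear.linear[OF bounded_linear_blinfun_compose_left]]
        linear_cmul[OF bounded_linear.linear[OF bounded_linear_blinfun_compose_right]])
  ultimately show ?thesis using sums_unique2 by fastforce
qed

lemma exp_op_scaleR_commute:
  fixes A :: "'a :: banach \<Rightarrow>\<^sub>L 'a"
  shows "A o\<^sub>L exp_op (t *\<^sub>R A) = exp_op (t *\<^sub>R A) o\<^sub>L A"
proof (cases "t = 0")
  case False
  have "t *\<^sub>R (A o\<^sub>L exp_op (t *\<^sub>R A)) = t *\<^sub>R (exp_op (t *\<^sub>R A) o\<^sub>L A)"
    using exp_op_commute[of "t *\<^sub>R A"]
    by (simp add: linear_cmul[OF bounded_linear.linear[OF bounded_linear_blinfun_compose_left]]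
        linear_cmul[OF bounded_linear.linear[OF bounded_linear_blinfun_compose_right]])
  then show ?thesis using False by simp
qed (auto intro: blinfun_eqI simp: exp_op_zero)

lemma exp_op_has_vector_derivative:
  fixes A :: "'a :: banach \<Rightarrow>\<^sub>L 'a"
  shows "((\<lambda>t. exp_op (t *\<^sub>R A)) has_vector_derivative (A o\<^sub>L exp_op (t *\<^sub>R A))) (at t)"
proof -
  define r where "r = \<bar>t\<bar> + 1"
  define S where "S = {-r<..<r}"
  define f where "f n x = (x ^ n / fact n) *\<^sub>R power_op A n" for n and x :: real
  define F where "F n x = (real n * x ^ (n - 1) / fact n) *\<^sub>R power_op A n" for n and x :: real
  have S: "open S" "convex S" "t \<in> S" by (auto simp: S_def r_def)
  have f_sums: "(\<lambda>n. f n x) sums exp_op (x *\<^sub>R A)" for x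
    using exp_op_sums[of "x *\<^sub>R A"] by (simp add: f_def power_op_scaleR divide_inverse mult.commute)
  have F_Suc: "F (Suc n) x = A o\<^sub>L f n x" for n x
    by (simp add: F_def f_def power_op_Suc linear_cmul[OF bounded_linear.linear[OF bounded_linear_blinfun_compose_right]]
        del: of_nat_Suc)
  have "(\<lambda>n. F (Suc n) x) sums (A o\<^sub>L exp_op (x *\<^sub>R A))" for x
    unfolding F_Suc by (rule bounded_linear.sums[OF bounded_linear_blinfun_compose_right f_sums])
  then have F_sums: "(\<lambda>n. F n x) sums (A o\<^sub>L exp_op (x *\<^sub>R A))" for x
    using sums_Suc_iff[of "\<lambda>n. F n x" "A o\<^sub>L exp_op (x *\<^sub>R A)"] by (simp add: F_def)
  define M where "M n = (real n * r ^ (n - 1) / fact n) * norm A ^ n" for n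
  have "summable (\<lambda>n. M (Suc n))"
  proof -
    have "M (Suc n) = norm A * (inverse (fact n) * (r * norm A) ^ n)" for n
      by (simp add: M_def power_mult_distrib divide_inverse del: of_nat_Suc)
    then show ?thesis using summable_mult[OF summable_exp[of "r * norm A"], of "norm A"] by simp
  qed
  then have "summable M" by (simp only: summable_Suc_iff)
  have F_bound: "norm (F n x) \<le> M n" if "x \<in> S" for n x
  proof -
    have "\<bar>x\<bar> ^ (n - 1) \<le> r ^ (n - 1)" using that by (intro power_mono) (auto simp: S_def)
    then have "real n * \<bar>x\<bar> ^ (n - 1) / fact n \<le> real n * r ^ (n - 1) / fact n"
      by (intro divide_right_mono mult_left_mono) simp_all
    then show ?thesis
      unfolding F_def M_def norm_scaleR
      by (intro mult_mono norm_power_op) (simp_all add: abs_mult power_abs r_def)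
  qed
  have "uniform_limit S (\<lambda>n x. \<Sum>i<n. F i x) (\<lambda>x. \<Sum>i. F i x) sequentially"
    using F_bound \<open>summable M\<close> by (rule Weierstrass_m_test)
  moreover have "(\<Sum>i. F i x) = A o\<^sub>L exp_op (x *\<^sub>R A)" for x
    using sums_unique[OF F_sums] by simp
  ultimately have ul: "uniform_limit S (\<lambda>n x. \<Sum>i<n. F i x) (\<lambda>x. A o\<^sub>L exp_op (x *\<^sub>R A)) sequentially"
    by simp
  have "\<exists>g. \<forall>x\<in>S. (\<lambda>n. f n x) sums g x \<and>
      (g has_derivative (\<lambda>h. h *\<^sub>R (A o\<^sub>L exp_op (x *\<^sub>R A)))) (at x within S)"
  proof (rule has_derivative_series[OF S(2) _ _ S(3) f_sums])
    show "(f n has_derivative (\<lambda>h. h *\<^sub>R F n x)) (at x within S)" for n x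
    proof -
      have "((\<lambda>x. x ^ n / fact n) has_real_derivative (real n * x ^ (n - 1) / fact n)) (at x within S)"
        by (auto intro!: derivative_eq_intros)
      from has_vector_derivative_scaleR[OF this has_vector_derivative_const[of "power_op A n"]]
      show ?thesis by (simp add: f_def[abs_def] F_def has_vector_derivative_def)
    qed
    fix e :: real assume "e > 0"
    from uniform_limitD[OF ul this]
    show "\<forall>\<^sub>F n in sequentially. \<forall>x\<in>S. \<forall>h.
        norm ((\<Sum>i<n. h *\<^sub>R F i x) - h *\<^sub>R (A o\<^sub>L exp_op (x *\<^sub>R A))) \<le> e * norm h"
    proof eventually_elim
      case (elim n)
      show ?case
      proof (intro ballI allI)
        fix x h assume "x \<in> S"
        have "norm ((\<Sum>i<n. h *\<^sub>R F i x) - h *\<^sub>R (A o\<^sub>L exp_op (x *\<^sub>R A)))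
            = \<bar>h\<bar> * norm ((\<Sum>i<n. F i x) - (A o\<^sub>L exp_op (x *\<^sub>R A)))"
          by (simp only: scaleR_sum_right[symmetric] scaleR_diff_right[symmetric] norm_scaleR)
        also have "\<dots> \<le> \<bar>h\<bar> * e"
          using elim \<open>x \<in> S\<close> by (intro mult_left_mono) (auto simp: dist_norm less_imp_le)
        finally show "norm ((\<Sum>i<n. h *\<^sub>R F i x) - h *\<^sub>R (A o\<^sub>L exp_op (x *\<^sub>R A))) \<le> e * norm h"
          by (simp add: mult.commute)
      qed
    qed
  qed
  then obtain g where g: "\<And>x. x \<in> S \<Longrightarrow> (\<lambda>n. f n x) sums g x"
    "\<And>x. x \<in> S \<Longrightarrow> (g has_derivative (\<lambda>h. h *\<^sub>R (A o\<^sub>L exp_op (x *\<^sub>R A)))) (at x within S)"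
    by blast
  have "(g has_derivative (\<lambda>h. h *\<^sub>R (A o\<^sub>L exp_op (t *\<^sub>R A)))) (at t)"
    using g(2)[OF S(3)] at_within_open[OF S(3,1)] by simp
  then have "((\<lambda>x. exp_op (x *\<^sub>R A)) has_derivative (\<lambda>h. h *\<^sub>R (A o\<^sub>L exp_op (t *\<^sub>R A)))) (at t)"
    by (rule has_derivative_transform_within_open[OF _ S(1,3)]) (use g(1) f_sums sums_unique2 in blast)
  then show ?thesis by (simp add: has_vector_derivative_def)
qed

lemma exp_op_isometry:
  fixes C :: "'a :: banach \<Rightarrow>\<^sub>L 'a" and s :: "'a \<Rightarrow> 'a \<Rightarrow> real"
  assumes s: "bounded_bilinear s" and skew: "\<And>x y. s (C x) y + s x (C y) = 0"
  shows "s (exp_op (t *\<^sub>R C) x) (exp_op (t *\<^sub>R C) x) = s x x"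
proof -
  define u where "u t = exp_op (t *\<^sub>R C) x" for t
  have u: "(u has_vector_derivative C (u t)) (at t)" for t
    using bounded_linear.has_vector_derivative[OF blinfun.bounded_linear_left[of x]
        exp_op_has_vector_derivative[of C t]]
    by (simp add: u_def[abs_def])
  have "((\<lambda>t. s (u t) (u t)) has_vector_derivative 0) (at t within UNIV)" for t
    using bounded_bilinear.has_vector_derivative[OF s u u, of t] skew[of "u t" "u t"]
    by (simp add: add.commute)
  then obtain c where c: "\<And>t. t \<in> UNIV \<Longrightarrow> s (u t) (u t) = c"
    using has_vector_derivative_zero_constant[of UNIV] by (metis convex_UNIV)
  have "u 0 = x" by (simp add: u_def exp_op_zero)
  then show ?thesis using c[of t] c[of 0] by (simp add: u_def)
qed

text \<open>
  The time derivative of the conjugated operator \<open>Y\<close> is the conjugate of a commutator, so the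
  integral over the conjugated commutator stays bounded.
\<close>

lemma norm_integral_conjugated_le:
  fixes C Y R Z :: "'a :: banach \<Rightarrow>\<^sub>L 'a"
  assumes bound: "\<And>t. norm (exp_op (t *\<^sub>R C)) \<le> c" and "T \<ge> 0"
    and Z: "Z = ((Y o\<^sub>L C) - (C o\<^sub>L Y)) + R"
  shows "norm (integral {0..T} (\<lambda>t. exp_op (t *\<^sub>R (- C)) o\<^sub>L Z o\<^sub>L exp_op (t *\<^sub>R C)))
    \<le> 2 * c\<^sup>2 * norm Y + T * c\<^sup>2 * norm R"
proof -
  define \<Phi> where "\<Phi> X t = exp_op (t *\<^sub>R (- C)) o\<^sub>L X o\<^sub>L exp_op (t *\<^sub>R C)" for X t
  have c0: "c \<ge> 0" using bound[of 0] norm_ge_zero order_trans by blast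
  have bound': "norm (\<Phi> X t) \<le> c\<^sup>2 * norm X" for X t
  proof -
    have "norm (\<Phi> X t) \<le> norm (exp_op (t *\<^sub>R (- C))) * norm X * norm (exp_op (t *\<^sub>R C))"
      unfolding \<Phi>_def
      by (intro order.trans[OF norm_blinfun_compose] mult_right_mono norm_blinfun_compose norm_ge_zero)
    also have "\<dots> \<le> c * norm X * c"
      using bound[of "- t"] bound[of t] c0 by (intro mult_mono mult_nonneg_nonneg) auto
    finally show ?thesis by (simp add: power2_eq_square mult_ac)
  qed
  note diff = linear_diff[OF bounded_linear.linear[OF bounded_linear_blinfun_compose_left]]
    linear_diff[OF bounded_linear.linear[OF bounded_linear_blinfun_compose_right]]
    and add = linear_add[OF bounded_linear.linear[OF bounded_linear_blinfun_compose_left]]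
    linear_add[OF bounded_linear.linear[OF bounded_linear_blinfun_compose_right]]
    and neg = linear_neg[OF bounded_linear.linear[OF bounded_linear_blinfun_compose_left]]
    linear_neg[OF bounded_linear.linear[OF bounded_linear_blinfun_compose_right]]
  have deriv: "(\<Phi> X has_vector_derivative \<Phi> ((X o\<^sub>L C) - (C o\<^sub>L X)) t) (at t)" for X t
  proof -
    have "((\<lambda>t. exp_op (t *\<^sub>R (- C)) o\<^sub>L X) has_vector_derivative
        ((- C o\<^sub>L exp_op (t *\<^sub>R (- C))) o\<^sub>L X)) (at t)"
      by (rule bounded_linear.has_vector_derivative[OF bounded_linear_blinfun_compose_left exp_op_has_vector_derivative])
    from bounded_bilinear.has_vector_derivative[OF bounded_bilinear_blinfun_compose this
        exp_op_has_vector_derivative[of C t]]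
    have "(\<Phi> X has_vector_derivative
        ((exp_op (t *\<^sub>R (- C)) o\<^sub>L X) o\<^sub>L (C o\<^sub>L exp_op (t *\<^sub>R C))) +
        (((- C o\<^sub>L exp_op (t *\<^sub>R (- C))) o\<^sub>L X) o\<^sub>L exp_op (t *\<^sub>R C))) (at t)"
      by (simp add: \<Phi>_def[abs_def])
    then show ?thesis
      unfolding exp_op_scaleR_commute[of "- C"]
      by (simp add: \<Phi>_def diff neg blinfun_compose_assoc)
  qed
  have "(\<Phi> ((Y o\<^sub>L C) - (C o\<^sub>L Y)) has_integral \<Phi> Y T - \<Phi> Y 0) {0..T}"
    by (rule fundamental_theorem_of_calculus[OF \<open>T \<ge> 0\<close> has_vector_derivative_at_within[OF deriv]])
  moreover have cont: "continuous_on {0..T} (\<Phi> R)"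
    using deriv[of R]
    by (auto intro!: continuous_at_imp_continuous_on has_vector_derivative_continuous)
  then have "(\<Phi> R has_integral integral {0..T} (\<Phi> R)) {0..T}"
    by (intro integrable_integral integrable_continuous_real)
  ultimately have "((\<lambda>t. \<Phi> ((Y o\<^sub>L C) - (C o\<^sub>L Y)) t + \<Phi> R t) has_integral
      (\<Phi> Y T - \<Phi> Y 0) + integral {0..T} (\<Phi> R)) {0..T}"
    by (rule has_integral_add)
  moreover have "\<Phi> ((Y o\<^sub>L C) - (C o\<^sub>L Y)) t + \<Phi> R t = \<Phi> Z t" for t
    by (simp add: \<Phi>_def Z add)
  ultimately have int: "integral {0..T} (\<Phi> Z) = (\<Phi> Y T - \<Phi> Y 0) + integral {0..T} (\<Phi> R)"
    by (simp add: integral_unique)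
  have "norm (integral {0..T} (\<Phi> R)) \<le> (c\<^sup>2 * norm R) * (T - 0)"
    by (rule integral_bound[OF \<open>T \<ge> 0\<close> cont bound'])
  moreover have "norm (\<Phi> Y T - \<Phi> Y 0) \<le> c\<^sup>2 * norm Y + c\<^sup>2 * norm Y"
    by (intro order.trans[OF norm_triangle_ineq4] add_mono bound')
  ultimately have "norm (integral {0..T} (\<Phi> Z)) \<le> 2 * c\<^sup>2 * norm Y + T * c\<^sup>2 * norm R"
    using norm_triangle_ineq[of "\<Phi> Y T - \<Phi> Y 0" "integral {0..T} (\<Phi> R)"]
    unfolding int by (simp add: mult_ac)
  then show ?thesis unfolding \<Phi>_def[abs_def] .
qed

section \<open>Scalar products close to the given one\<close>

lemma norm_diff_id_le:
  fixes L :: "'a :: real_normed_vector \<Rightarrow>\<^sub>L 'a"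
  shows "norm (L x - x) \<le> norm (L - id_blinfun) * norm x"
  using norm_blinfun[of "L - id_blinfun" x] by (simp add: minus_blinfun.rep_eq)

lemma form_near_id:
  fixes L :: "'a :: complex_inner \<Rightarrow>\<^sub>L 'a"
  assumes "norm (L - id_blinfun) \<le> 1 / 2"
  shows "(norm x)\<^sup>2 \<le> 2 * Re (cinner x (L x))" "2 * Re (cinner x (L x)) \<le> 3 * (norm x)\<^sup>2"
proof -
  have "\<bar>Re (cinner x (L x - x))\<bar> \<le> norm x * norm (L x - x)" by (rule Re_cinner_le)
  also have "\<dots> \<le> norm x * (1 / 2 * norm x)"
    using assms by (intro mult_left_mono order.trans[OF norm_diff_id_le] mult_right_mono) simp_all
  finally have "\<bar>Re (cinner x (L x)) - (norm x)\<^sup>2\<bar> \<le> (norm x)\<^sup>2 / 2"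
    by (simp add: cinner.diff_right Re_cinner_self power2_eq_square)
  then show "(norm x)\<^sup>2 \<le> 2 * Re (cinner x (L x))" "2 * Re (cinner x (L x)) \<le> 3 * (norm x)\<^sup>2"
    by linarith+
qed

lemma opnorm_wrt_near_id:
  fixes L A :: "'a :: complex_inner \<Rightarrow>\<^sub>L 'a"
  assumes L: "norm (L - id_blinfun) \<le> 1 / 2"
  shows "0 \<le> opnorm_wrt (scalar_prod L) A" "opnorm_wrt (scalar_prod L) A \<le> 2 * norm A"
proof -
  define N where "N = norm_wrt (scalar_prod L)"
  have N: "(N x)\<^sup>2 = Re (cinner x (L x))" "0 \<le> N x" for x
  proof -
    have "0 \<le> Re (cinner x (L x))" using form_near_id(1)[OF L, of x] by (smt (verit) zero_le_power2)
    then show "(N x)\<^sup>2 = Re (cinner x (L x))" "0 \<le> N x"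
      by (simp_all add: N_def norm_wrt_def scalar_prod_def)
  qed
  have le: "N (A x) / N x \<le> 2 * norm A" for x
  proof (cases "N x = 0")
    case False
    have "2 * (N (A x))\<^sup>2 \<le> 3 * (norm (A x))\<^sup>2"
      unfolding N by (rule form_near_id(2)[OF L])
    also have "\<dots> \<le> 3 * ((norm A)\<^sup>2 * (norm x)\<^sup>2)"
      using power_mono[OF norm_blinfun[of A x], of 2] by (simp add: power_mult_distrib)
    also have "\<dots> \<le> 3 * ((norm A)\<^sup>2 * (2 * (N x)\<^sup>2))"
      unfolding N by (intro mult_left_mono form_near_id(1)[OF L]) simp_all
    finally have "(N (A x))\<^sup>2 \<le> 3 * ((norm A)\<^sup>2 * (N x)\<^sup>2)" by (simp add: mult_ac)
    also have "\<dots> \<le> (2 * norm A * N x)\<^sup>2"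
      by (simp add: power_mult_distrib mult_right_mono)
    finally have "N (A x) \<le> 2 * norm A * N x"
      by (rule power2_le_imp_le) (simp add: N(2))
    moreover have "N x > 0" using False N(2)[of x] by simp
    ultimately show ?thesis by (simp add: divide_le_eq)
  qed simp
  have "bdd_above (range (\<lambda>x. N (A x) / N x))" using le by (intro bdd_aboveI2)
  then have "N (A 0) / N 0 \<le> (SUP x. N (A x) / N x)" by (rule cSUP_upper[OF UNIV_I])
  moreover have "N 0 = 0" by (simp add: N_def norm_wrt_def scalar_prod_def)
  ultimately show "0 \<le> opnorm_wrt (scalar_prod L) A" by (simp add: opnorm_wrt_def N_def)
  show "opnorm_wrt (scalar_prod L) A \<le> 2 * norm A"
    unfolding opnorm_wrt_def N_def[symmetric] by (rule cSUP_least) (use le in auto)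
qed

lemma inverse_op_near_id:
  fixes L K :: "'a :: complex_normed_vector \<Rightarrow>\<^sub>L 'a"
  assumes L: "norm (L - id_blinfun) \<le> 1 / 2" "automorphism L"
  shows "norm ((inverse_op L o\<^sub>L K) - K) \<le> 2 * norm (L - id_blinfun) * norm K"
proof (rule norm_blinfun_bound)
  fix x
  define u where "u = inv (blinfun_apply L) (K x)"
  have "surj (blinfun_apply L)" and bl: "bounded_linear (inv (blinfun_apply L))"
    using L(2) by (auto simp: automorphism_def bij_is_surj)
  then have Lu: "L u = K x" by (simp add: u_def surj_f_inv_f)
  have *: "norm (u - K x) \<le> norm (L - id_blinfun) * norm u"
    using norm_diff_id_le[of L u] by (simp add: Lu norm_minus_commute)
  also have "\<dots> \<le> 1 / 2 * norm u" using L(1) by (rule mult_right_mono) simp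
  finally have "norm u \<le> 2 * norm (K x)" using norm_triangle_sub[of u "K x"] by simp
  also have "\<dots> \<le> 2 * (norm K * norm x)" using norm_blinfun[of K x] by simp
  finally have "norm (L - id_blinfun) * norm u \<le> norm (L - id_blinfun) * (2 * (norm K * norm x))"
    by (rule mult_left_mono) simp
  moreover have "((inverse_op L o\<^sub>L K) - K) x = u - K x"
    by (simp add: inverse_op_def bounded_linear_Blinfun_apply[OF bl] u_def minus_blinfun.rep_eq)
  ultimately show "norm (((inverse_op L o\<^sub>L K) - K) x) \<le> 2 * norm (L - id_blinfun) * norm K * norm x"
    using * by (simp add: mult_ac)
qed simp

lemma orth_compl_ker_op:
  assumes "selfadjoint L" "automorphism L"
  shows "orth_compl_wrt (scalar_prod L) (ker_op (B o\<^sub>L L)) = ker_perp B"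
proof -
  have surj: "surj (blinfun_apply L)" using assms(2) by (simp add: automorphism_def bij_is_surj)
  have "(\<forall>x. B (L x) = 0 \<longrightarrow> cinner (L x) y = 0) \<longleftrightarrow> (\<forall>w. B w = 0 \<longrightarrow> cinner w y = 0)" for y
    using surj by (metis surj_f_inv_f)
  then show ?thesis
    by (auto simp: orth_compl_wrt_def ker_op_def ker_perp_def scalar_prod_def selfadjointD[OF assms(1)])
qed

text \<open>
  The \<open>L\<close>-orthogonal projection \<open>y\<close> of \<open>x\<close> is the fixed point of the
  contraction \<open>y \<mapsto> P x + P ((L - 1) (x - y))\<close>.
\<close>

lemma orth_proj_near_id:
  fixes B L P :: "'a :: complex_hilbert \<Rightarrow>\<^sub>L 'a"
  assumes L: "norm (L - id_blinfun) \<le> 1 / 2"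
    and P: "\<And>x. P x \<in> ker_perp B" "\<And>x. B (x - P x) = 0" "\<And>x. norm (P x) \<le> norm x"
      "\<And>x. B x = 0 \<Longrightarrow> P x = 0" "\<And>x. x \<in> ker_perp B \<Longrightarrow> P x = x"
  defines "Q \<equiv> orth_proj_wrt (scalar_prod L) (ker_perp B)"
  shows "norm Q \<le> 3" "norm (Q - P) \<le> 4 * norm (L - id_blinfun)"
proof -
  define D where "D = L - id_blinfun"
  have D: "norm D \<le> 1 / 2" "L x = x + D x" for x
    using L by (simp_all add: D_def minus_blinfun.rep_eq)
  have PD: "norm (P (D x)) \<le> norm D * norm x" for x
    using P(3)[of "D x"] norm_blinfun[of D x] by (rule order.trans)
  have PD': "norm (P (D x)) \<le> 1 / 2 * norm x" for x
    using PD[of x] mult_right_mono[OF D(1), of "norm x"] by simp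
  have perp: "P v = 0 \<longleftrightarrow> (\<forall>m\<in>ker_perp B. cinner m v = 0)" for v
  proof
    assume "P v = 0"
    then have "B v = 0" using P(2)[of v] by simp
    then show "\<forall>m\<in>ker_perp B. cinner m v = 0" using ker_perp_cinner_zero by blast
  next
    assume "\<forall>m\<in>ker_perp B. cinner m v = 0"
    then have "cinner (P v) v = 0" using P(1) by blast
    moreover have "cinner (P v) (v - P v) = 0" using ker_perp_cinner_zero[OF P(1) P(2)] .
    ultimately have "cinner (P v) (P v) = 0" by (simp add: cinner.diff_right)
    then show "P v = 0" by (simp add: cinner_self)
  qed
  define fix_at where "fix_at x y \<longleftrightarrow> P x + P (D (x - y)) = y" for x y
  have fix_iff: "fix_at x y \<longleftrightarrow> y \<in> ker_perp B \<and> x - y \<in> orth_compl_wrt (scalar_prod L) (ker_perp B)" for x y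
  proof -
    have "x - y \<in> orth_compl_wrt (scalar_prod L) (ker_perp B) \<longleftrightarrow> P (L (x - y)) = 0"
      by (simp add: orth_compl_wrt_def scalar_prod_def perp)
    moreover have "P (L (x - y)) = P x + P (D (x - y)) - P y"
      by (simp add: D(2) blinfun.add_right blinfun.diff_right)
    moreover have "fix_at x y \<Longrightarrow> y \<in> ker_perp B"
      unfolding fix_at_def using P(1)[of "x + D (x - y)"] by (simp add: blinfun.add_right)
    ultimately show ?thesis using P(5)[of y] by (auto simp: fix_at_def)
  qed
  have ex1: "\<exists>!y. fix_at x y" for x
    unfolding fix_at_def
  proof (rule banach_fix_type[of "1/2"])
    show "\<forall>y z. dist (P x + P (D (x - y))) (P x + P (D (x - z))) \<le> 1 / 2 * dist y z"
    proof (intro allI)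
      fix y z
      have "P x + P (D (x - y)) - (P x + P (D (x - z))) = P (D (z - y))"
        by (simp add: blinfun.diff_right)
      then show "dist (P x + P (D (x - y))) (P x + P (D (x - z))) \<le> 1 / 2 * dist y z"
        using PD'[of "z - y"] by (simp add: dist_norm norm_minus_commute)
    qed
  qed simp_all
  define p where "p x = (THE y. fix_at x y)" for x
  have p: "fix_at x (p x)" for x unfolding p_def by (rule theI'[OF ex1])
  have uniq: "p x = y" if "fix_at x y" for x y using ex1 p that by blast
  have p_add: "p (x + y) = p x + p y" for x y
  proof (rule uniq)
    have eq: "x + y - (p x + p y) = (x - p x) + (y - p y)" by simp
    show "fix_at (x + y) (p x + p y)"
      using p[of x] p[of y] unfolding fix_at_def eq by (simp add: blinfun.add_right add_ac) (metis add.assoc add.left_commute)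
  qed
  have p_scale: "p (r *\<^sub>R x) = r *\<^sub>R p x" for r x
  proof (rule uniq)
    have eq: "r *\<^sub>R x - r *\<^sub>R p x = r *\<^sub>R (x - p x)" by (simp add: scaleR_diff_right)
    show "fix_at (r *\<^sub>R x) (r *\<^sub>R p x)"
      using p[of x] unfolding fix_at_def eq by (metis blinfun.scaleR_right scaleR_add_right)
  qed
  have diff: "norm (p x - P x) \<le> norm D * norm (x - p x)" for x
    using p[of x] PD[of "x - p x"] unfolding fix_at_def by (metis add_diff_cancel_left')
  have p3: "norm (p x) \<le> 3 * norm x" for x
  proof -
    have "norm (p x - P x) \<le> 1 / 2 * (norm x + norm (p x))"
      using diff[of x] mult_mono[OF D(1) norm_triangle_ineq4[of x "p x"]] by simp
    then show ?thesis using norm_triangle_sub[of "p x" "P x"] P(3)[of x] by simp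
  qed
  have bl: "bounded_linear p"
    by (rule bounded_linear_intro[where K = 3]) (use p3 in \<open>simp_all add: p_add p_scale mult.commute\<close>)
  have "Q = Blinfun p" unfolding Q_def orth_proj_wrt_def p_def fix_iff ..
  then have Q: "Q x = p x" for x by (simp add: bounded_linear_Blinfun_apply[OF bl])
  show "norm Q \<le> 3" by (rule norm_blinfun_bound) (simp_all add: Q p3)
  show "norm (Q - P) \<le> 4 * norm (L - id_blinfun)"
  proof (rule norm_blinfun_bound)
    fix x
    have "norm (x - p x) \<le> 4 * norm x" using norm_triangle_ineq4[of x "p x"] p3[of x] by simp
    then have "norm D * norm (x - p x) \<le> norm D * (4 * norm x)" by (rule mult_left_mono) simp
    then show "norm ((Q - P) x) \<le> 4 * norm (L - id_blinfun) * norm x"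
      using diff[of x] by (simp add: minus_blinfun.rep_eq Q D_def)
  qed simp
qed

lemma bounded_bilinear_Re_cinner: "bounded_bilinear (\<lambda>x y. Re (cinner x y))"
proof
  show "\<exists>K. \<forall>a b :: 'a. norm (Re (cinner a b)) \<le> norm a * norm b * K"
    by (rule exI[of _ 1]) (simp add: Re_cinner_le)
qed (simp_all add: cinner_add_left cinner_add_right cinner_scaleR_left cinner_scaleR_right)

lemma norm_exp_op_near_id:
  fixes B L :: "'a :: complex_hilbert \<Rightarrow>\<^sub>L 'a"
  assumes L: "norm (L - id_blinfun) \<le> 1 / 2" "selfadjoint L" and B: "selfadjoint B"
  shows "norm (exp_op (t *\<^sub>R ((\<i> * complex_of_real r) *\<^sub>C (B o\<^sub>L L)))) \<le> 2"
proof (rule norm_blinfun_bound)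
  fix x
  define C where "C = (\<i> * complex_of_real r) *\<^sub>C (B o\<^sub>L L)"
  define s where "s x y = Re (cinner x (L y))" for x y
  have "bounded_bilinear s"
    unfolding s_def[abs_def]
    using bounded_bilinear.comp[OF bounded_bilinear_Re_cinner bounded_linear_ident blinfun.bounded_linear_right] .
  moreover have "s (C y) z + s y (C z) = 0" for y z
  proof -
    have "cinner (B (L y)) (L z) = cinner y (L (B (L z)))"
      by (simp add: selfadjointD[OF B] selfadjointD[OF L(2)])
    then show ?thesis
      by (simp add: s_def C_def scaleC_blinfun.rep_eq cinner_scaleC_left cinner_scaleC_right
          clinear_opsD[OF selfadjoint_clinear[OF L(2)]])
  qed
  ultimately have "s (exp_op (t *\<^sub>R C) x) (exp_op (t *\<^sub>R C) x) = s x x"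
    by (rule exp_op_isometry)
  then have "(norm (exp_op (t *\<^sub>R C) x))\<^sup>2 \<le> 3 * (norm x)\<^sup>2"
    using form_near_id(1)[OF L(1), of "exp_op (t *\<^sub>R C) x"] form_near_id(2)[OF L(1), of x]
    by (simp add: s_def)
  also have "\<dots> \<le> (2 * norm x)\<^sup>2" by (simp add: power_mult_distrib)
  finally show "norm (exp_op (t *\<^sub>R C) x) \<le> 2 * norm x" by (rule power2_le_imp_le) simp
qed simp

lemma bounded_holomorphic_family_Lipschitz_at_0:
  fixes L :: "real \<Rightarrow> 'a :: {complex_normed_vector, banach} \<Rightarrow>\<^sub>L 'a"
  assumes "bounded_holomorphic_family L"
  obtains r M where "r > 0" "\<And>\<eta>. 0 \<le> \<eta> \<Longrightarrow> \<eta> \<le> 1 \<Longrightarrow> \<eta> \<le> r \<Longrightarrow> norm (L \<eta> - L 0) \<le> M * \<eta>"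
proof -
  obtain a r where r: "r > 0"
    and *: "\<forall>\<eta>\<in>{0..1}. \<bar>\<eta> - 0\<bar> < r \<longrightarrow> (\<lambda>n. (\<eta> - 0) ^ n *\<^sub>R a n) sums L \<eta>"
    using assms[unfolded bounded_holomorphic_family_def, THEN bspec, of 0] by auto
  have sums: "(\<lambda>n. \<eta> ^ n *\<^sub>R a n) sums L \<eta>" if "0 \<le> \<eta>" "\<eta> \<le> 1" "\<eta> < r" for \<eta>
    using *[THEN bspec, of \<eta>] that by simp
  define q where "q = min 1 (r / 2)"
  have q: "q > 0" "q \<le> 1" "q < r" using r by (auto simp: q_def)
  have "(\<lambda>n. q ^ n *\<^sub>R a n) \<longlonglongrightarrow> 0"
    using q by (intro summable_LIMSEQ_zero sums_summable[OF sums]) auto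
  then obtain K where K: "\<And>n. norm (q ^ n *\<^sub>R a n) \<le> K"
    using Bseq_def[of "\<lambda>n. q ^ n *\<^sub>R a n"] by (auto dest!: convergentI convergent_imp_Bseq)
  have a0: "L 0 = a 0"
  proof -
    have "(\<lambda>n. 0 ^ n *\<^sub>R a n) = (\<lambda>n. if n = 0 then a n else 0)" by (auto simp: fun_eq_iff)
    then show ?thesis using sums[of 0] r sums_single[of 0 a] sums_unique2 by fastforce
  qed
  have Lipschitz: "norm (L \<eta> - L 0) \<le> (2 * K / q) * \<eta>" if \<eta>: "0 \<le> \<eta>" "\<eta> \<le> 1" "\<eta> \<le> q / 2" for \<eta>
  proof -
    have "(\<lambda>n. \<eta> ^ n *\<^sub>R a n) sums L \<eta>" using \<eta> q by (intro sums) auto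
    then have S: "(\<lambda>n. \<eta> ^ Suc n *\<^sub>R a (Suc n)) sums (L \<eta> - L 0)"
      using sums_Suc_iff[of "\<lambda>n. \<eta> ^ n *\<^sub>R a n" "L \<eta> - L 0"] by (simp add: a0)
    have term_le: "norm (\<eta> ^ Suc n *\<^sub>R a (Suc n)) \<le> K * \<eta> / q * (1 / 2) ^ n" for n
    proof -
      have "\<eta> ^ Suc n *\<^sub>R a (Suc n) = (\<eta> / q) ^ Suc n *\<^sub>R (q ^ Suc n *\<^sub>R a (Suc n))"
        using q by (simp add: power_divide)
      then have "norm (\<eta> ^ Suc n *\<^sub>R a (Suc n)) = (\<eta> / q) ^ Suc n * norm (q ^ Suc n *\<^sub>R a (Suc n))"
        using \<eta> q by (metis abs_of_nonneg divide_nonneg_pos norm_scaleR zero_le_power)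
      also have "\<dots> \<le> (\<eta> / q) ^ Suc n * K"
        using K[of "Suc n"] \<eta> q by (intro mult_left_mono) (simp_all only: zero_le_power divide_nonneg_pos)
      also have "\<dots> \<le> (\<eta> / q * (1 / 2) ^ n) * K"
      proof (rule mult_right_mono)
        have "(\<eta> / q) ^ n \<le> (1 / 2) ^ n" using \<eta> q by (intro power_mono) (auto simp: field_simps)
        then show "(\<eta> / q) ^ Suc n \<le> \<eta> / q * (1 / 2) ^ n"
          unfolding power_Suc using \<eta> q by (intro mult_left_mono) auto
        show "0 \<le> K" using K[of 0] norm_ge_zero order_trans by blast
      qed
      finally show ?thesis by (simp add: mult_ac)
    qed
    have G: "(\<lambda>n. K * \<eta> / q * (1 / 2) ^ n) sums (K * \<eta> / q * 2)"
      using sums_mult[OF geometric_sums[of "1/2 :: real"], of "K * \<eta> / q"] by simp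
    have "norm (\<Sum>n. \<eta> ^ Suc n *\<^sub>R a (Suc n)) \<le> (\<Sum>n. K * \<eta> / q * (1 / 2) ^ n)"
      by (rule norm_suminf_le[OF term_le sums_summable[OF G]])
    then show ?thesis by (simp only: sums_unique[OF S, symmetric] sums_unique[OF G, symmetric]) (simp add: mult_ac)
  qed
  show thesis by (rule that[of "q / 2", OF _ Lipschitz]) (use q in simp)
qed

section \<open>The time average\<close>

lemma scaleC_compose_clinear:
  fixes A Z :: "'a :: complex_normed_vector \<Rightarrow>\<^sub>L 'a"
  assumes "A \<in> clinear_ops"
  shows "(c *\<^sub>C A) o\<^sub>L (d *\<^sub>C Z) = (c * d) *\<^sub>C (A o\<^sub>L Z)"
  by (rule blinfun_eqI) (simp add: scaleC_blinfun.rep_eq clinear_opsD[OF assms] scaleC_scaleC)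

lemma compact_op_precompact: "compact_op K \<Longrightarrow> precompact_op K"
  by (simp add: compact_op_def precompact_op_def)

lemma norm_compose_le:
  "norm A \<le> a \<Longrightarrow> norm B \<le> b \<Longrightarrow> norm (A o\<^sub>L B) \<le> a * b"
  by (rule order.trans[OF norm_blinfun_compose])
     (auto intro!: mult_mono order.trans[OF norm_ge_zero])

lemma conjugated_average_bound:
  fixes B L K P Q Y Li :: "'a :: complex_hilbert \<Rightarrow>\<^sub>L 'a"
  assumes L: "norm (L - id_blinfun) \<le> 1 / 2" "selfadjoint L" and B: "selfadjoint B"
    and Y: "Y \<in> clinear_ops" "norm ((K o\<^sub>L P) - commutator B Y) \<le> \<delta>"
    and Q: "norm Q \<le> 3" "norm (Q - P) \<le> 4 * norm (L - id_blinfun)"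
    and J: "norm (J - K) \<le> 2 * norm (L - id_blinfun) * norm K"
    and "\<epsilon> > 0" "T > 0"
  shows "opnorm_wrt (scalar_prod L) ((1 / T) *\<^sub>R integral {0..T} (\<lambda>t.
            exp_op ((- \<i> * complex_of_real (t / \<epsilon>)) *\<^sub>C (B o\<^sub>L L)) o\<^sub>L J o\<^sub>L Q o\<^sub>L
            exp_op ((\<i> * complex_of_real (t / \<epsilon>)) *\<^sub>C (B o\<^sub>L L))))
    \<le> 16 * norm Y / T * \<epsilon> + 8 * (\<delta> + norm (L - id_blinfun) * (10 * norm K + 2 * norm B * norm Y))"
    (is "opnorm_wrt _ (_ *\<^sub>R integral _ ?f) \<le> _")
proof -
  define D where "D = L - id_blinfun"
  define C where "C = (\<i> * complex_of_real (1 / \<epsilon>)) *\<^sub>C (B o\<^sub>L L)"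
  define Y' where "Y' = (\<i> * complex_of_real \<epsilon>) *\<^sub>C Y"
  define R where "R = (J o\<^sub>L Q) - commutator (B o\<^sub>L L) Y"
  have C_exp: "norm (exp_op (t *\<^sub>R C)) \<le> 2" for t
    unfolding C_def by (rule norm_exp_op_near_id) fact+
  have tC: "(\<i> * complex_of_real (t / \<epsilon>)) *\<^sub>C (B o\<^sub>L L) = t *\<^sub>R C"
    "(- \<i> * complex_of_real (t / \<epsilon>)) *\<^sub>C (B o\<^sub>L L) = t *\<^sub>R (- C)" for t
    by (simp_all add: C_def scaleR_scaleC scaleC_scaleC scaleC_minus_left scaleC_minus_right mult_ac)
  have BL: "B o\<^sub>L L \<in> clinear_ops"
    using selfadjoint_clinear[OF B] selfadjoint_clinear[OF L(2)] by (simp add: clinear_ops_def)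
  have ii: "\<i> * complex_of_real \<epsilon> * (\<i> * complex_of_real (1 / \<epsilon>)) = -1"
    "\<i> * complex_of_real (1 / \<epsilon>) * (\<i> * complex_of_real \<epsilon>) = -1"
    using \<open>\<epsilon> > 0\<close> by (simp_all add: complex_eq_iff)
  have m1: "(-1) *\<^sub>C A = - A" for A :: "'a \<Rightarrow>\<^sub>L 'a"
    using scaleR_scaleC[of "-1" A] by simp
  have "(Y' o\<^sub>L C) - (C o\<^sub>L Y') = commutator (B o\<^sub>L L) Y"
    unfolding Y'_def C_def scaleC_compose_clinear[OF Y(1)] scaleC_compose_clinear[OF BL] ii m1
    by (simp add: commutator_def)
  then have Z: "J o\<^sub>L Q = ((Y' o\<^sub>L C) - (C o\<^sub>L Y')) + R" by (simp add: R_def)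
  have "norm (integral {0..T} (\<lambda>t. exp_op (t *\<^sub>R (- C)) o\<^sub>L (J o\<^sub>L Q) o\<^sub>L exp_op (t *\<^sub>R C)))
      \<le> 2 * 2\<^sup>2 * norm Y' + T * 2\<^sup>2 * norm R"
    by (rule norm_integral_conjugated_le[OF C_exp _ Z]) (use \<open>T > 0\<close> in simp)
  then have int: "norm (integral {0..T} ?f) \<le> 8 * \<epsilon> * norm Y + 4 * T * norm R"
    unfolding tC blinfun_compose_assoc using \<open>\<epsilon> > 0\<close>
    by (simp add: Y'_def norm_scaleC norm_mult)
  have "R = ((J - K) o\<^sub>L Q) + (K o\<^sub>L (Q - P)) + ((K o\<^sub>L P) - commutator B Y)
      - ((B o\<^sub>L (D o\<^sub>L Y)) - (Y o\<^sub>L (B o\<^sub>L D)))"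
    by (rule blinfun_eqI) (simp add: R_def D_def commutator_def blinfun.bilinear_simps)
  moreover have "norm (a + b + c - (d - e)) \<le> norm a + norm b + norm c + (norm d + norm e)"
    for a b c d e :: "'a \<Rightarrow>\<^sub>L 'a"
    using norm_triangle_ineq4[of "a + b + c" "d - e"] norm_triangle_ineq[of "a + b" c]
      norm_triangle_ineq[of a b] norm_triangle_ineq4[of d e] by linarith
  ultimately have "norm R \<le> norm ((J - K) o\<^sub>L Q) + norm (K o\<^sub>L (Q - P)) + norm ((K o\<^sub>L P) - commutator B Y)
      + (norm (B o\<^sub>L (D o\<^sub>L Y)) + norm (Y o\<^sub>L (B o\<^sub>L D)))"
    by (simp only:)
  also have "\<dots> \<le> (2 * norm D * norm K) * 3 + norm K * (4 * norm D) + \<delta>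
      + (norm B * (norm D * norm Y) + norm Y * (norm B * norm D))"
    using Q J Y(2)
    by (intro add_mono norm_compose_le) (simp_all add: D_def)
  finally have R: "norm R \<le> \<delta> + norm D * (10 * norm K + 2 * norm B * norm Y)"
    by (simp add: algebra_simps)
  have "opnorm_wrt (scalar_prod L) ((1 / T) *\<^sub>R integral {0..T} ?f) \<le> 2 * norm ((1 / T) *\<^sub>R integral {0..T} ?f)"
    by (rule opnorm_wrt_near_id(2)[OF L(1)])
  also have "\<dots> \<le> 2 * ((1 / T) * (8 * \<epsilon> * norm Y + 4 * T * norm R))"
    using int \<open>T > 0\<close> by (simp add: divide_right_mono)
  also have "\<dots> = 16 * norm Y / T * \<epsilon> + 8 * norm R"
    using \<open>T > 0\<close> by (simp add: field_simps)
  also have "\<dots> \<le> 16 * norm Y / T * \<epsilon> + 8 * (\<delta> + norm D * (10 * norm K + 2 * norm B * norm Y))"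
    using R by simp
  finally show ?thesis by (simp only: D_def)
qed

theorem theorem6p8:
  fixes B\<^sub>0 :: "'a :: complex_hilbert \<Rightarrow>\<^sub>L 'a"
    and \<Lambda> :: "real \<Rightarrow> 'a \<Rightarrow>\<^sub>L 'a"
    and S :: "real \<Rightarrow> 'a \<Rightarrow> 'a \<Rightarrow> complex"
    and B Pcont Kfam :: "real \<Rightarrow> 'a \<Rightarrow>\<^sub>L 'a"
    and Hcont :: "real \<Rightarrow> 'a set"
    and \<sigma> :: "real \<Rightarrow> real"
    and K :: "'a \<Rightarrow>\<^sub>L 'a"
    and T :: real
  assumes "selfadjoint B\<^sub>0"
    and "bounded_holomorphic_family \<Lambda>"
    and "\<And>\<eta>. \<eta> \<in> {0..1} \<Longrightarrow> automorphism (\<Lambda> \<eta>)"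
    and "\<Lambda> 0 = id_blinfun"
    and "\<And>\<eta>. \<eta> \<in> {0..1} \<Longrightarrow> selfadjoint (\<Lambda> \<eta>)"
    and "\<And>\<eta>\<^sub>1 \<eta>\<^sub>2. 0 \<le> \<eta>\<^sub>1 \<Longrightarrow> \<eta>\<^sub>1 \<le> \<eta>\<^sub>2 \<Longrightarrow> \<eta>\<^sub>2 \<le> 1 \<Longrightarrow> selfadjoint_le (\<Lambda> \<eta>\<^sub>1) (\<Lambda> \<eta>\<^sub>2)"
    and "\<And>\<eta>. \<eta> \<in> {0..1} \<Longrightarrow> S \<eta> = scalar_prod (\<Lambda> \<eta>)"
    and "\<And>\<eta>. \<eta> \<in> {0..1} \<Longrightarrow> B \<eta> = B\<^sub>0 o\<^sub>L \<Lambda> \<eta>"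
    and "\<And>\<eta>. \<eta> \<in> {0..1} \<Longrightarrow> point_spectrum (B \<eta>) = {0}"
    and "\<And>\<eta>. \<eta> \<in> {0..1} \<Longrightarrow> Hcont \<eta> = orth_compl_wrt (S \<eta>) (ker_op (B \<eta>))"
    and "\<And>\<eta>. \<eta> \<in> {0..1} \<Longrightarrow> Pcont \<eta> = orth_proj_wrt (S \<eta>) (Hcont \<eta>)"
    and "\<And>\<eta>. \<eta> \<in> {0..1} \<Longrightarrow> Kfam \<eta> = inverse_op (\<Lambda> \<eta>) o\<^sub>L K"
    and "continuous_on {0..1} \<sigma>" and "mono_on {0..1} \<sigma>"
    and "\<sigma> ` {0..1} \<subseteq> {0..1}" and "\<sigma> 0 = 0" and "\<sigma> 1 = 1"
    and "compact_op K"
    and "T > 0"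
  shows "((\<lambda>\<epsilon>. opnorm_wrt (S (\<sigma> \<epsilon>))
            ((1 / T) *\<^sub>R integral {0..T} (\<lambda>t.
               exp_op ((- \<i> * complex_of_real (t / \<epsilon>)) *\<^sub>C B (\<sigma> \<epsilon>)) o\<^sub>L
               Kfam (\<sigma> \<epsilon>) o\<^sub>L Pcont (\<sigma> \<epsilon>) o\<^sub>L
               exp_op ((\<i> * complex_of_real (t / \<epsilon>)) *\<^sub>C B (\<sigma> \<epsilon>)))))
          \<longlongrightarrow> 0) (at_right 0)"
proof -
  define D where "D \<epsilon> = norm (\<Lambda> (\<sigma> \<epsilon>) - id_blinfun)" for \<epsilon>
  define f where "f \<epsilon> = opnorm_wrt (S (\<sigma> \<epsilon>))
            ((1 / T) *\<^sub>R integral {0..T} (\<lambda>t.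
               exp_op ((- \<i> * complex_of_real (t / \<epsilon>)) *\<^sub>C B (\<sigma> \<epsilon>)) o\<^sub>L
               Kfam (\<sigma> \<epsilon>) o\<^sub>L Pcont (\<sigma> \<epsilon>) o\<^sub>L
               exp_op ((\<i> * complex_of_real (t / \<epsilon>)) *\<^sub>C B (\<sigma> \<epsilon>))))" for \<epsilon>
  have \<sigma>_mem: "\<sigma> \<epsilon> \<in> {0..1}" if "\<epsilon> \<in> {0<..<1}" for \<epsilon>
    using assms(15) that by (auto simp: image_subset_iff)
  have B0: "B 0 = B\<^sub>0" using assms(4,8) by (auto intro: blinfun_eqI)
  have spec: "point_spectrum B\<^sub>0 \<subseteq> {0}" using assms(9)[of 0] B0 by simp
  have K: "K \<in> clinear_ops" "precompact_op K"
    using \<open>compact_op K\<close> by (simp_all add: compact_op_precompact) (simp add: compact_op_def)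
  obtain P :: "'a \<Rightarrow>\<^sub>L 'a" where Pc: "P \<in> clinear_ops"
    and P: "\<And>x. P x \<in> ker_perp B\<^sub>0" "\<And>x. B\<^sub>0 (x - P x) = 0" "\<And>x. norm (P x) \<le> norm x"
      "\<And>x. B\<^sub>0 x = 0 \<Longrightarrow> P x = 0" "\<And>x. x \<in> ker_perp B\<^sub>0 \<Longrightarrow> P x = x"
    by (rule ker_perp_projection[OF selfadjoint_clinear[OF assms(1)]], rule that)
  have P1: "norm P \<le> 1" by (rule norm_blinfun_bound) (simp_all add: P(3))
  obtain r M where r: "r > 0"
    and M: "\<And>\<eta>. 0 \<le> \<eta> \<Longrightarrow> \<eta> \<le> 1 \<Longrightarrow> \<eta> \<le> r \<Longrightarrow> norm (\<Lambda> \<eta> - \<Lambda> 0) \<le> M * \<eta>"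
    using bounded_holomorphic_family_Lipschitz_at_0[OF assms(2)] by blast
  have ev01: "\<forall>\<^sub>F \<epsilon> in at_right 0. \<epsilon> \<in> {0<..<1 :: real}" by (rule eventually_at_right_real) simp
  have "(\<sigma> \<longlongrightarrow> \<sigma> 0) (at 0 within {0..1})"
    using assms(13) by (simp add: continuous_on)
  then have \<sigma>_lim: "(\<sigma> \<longlongrightarrow> 0) (at_right 0)"
    using assms(16) by (simp add: at_within_Icc_at_right)
  have D_lim: "(D \<longlongrightarrow> 0) (at_right 0)"
  proof (rule tendsto_sandwich[OF _ _ tendsto_const])
    show "((\<lambda>\<epsilon>. M * \<sigma> \<epsilon>) \<longlongrightarrow> 0) (at_right 0)" using tendsto_mult_right_zero[OF \<sigma>_lim] .
    show "\<forall>\<^sub>F \<epsilon> in at_right 0. D \<epsilon> \<le> M * \<sigma> \<epsilon>"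
      using ev01 order_tendstoD(2)[OF \<sigma>_lim r]
    proof eventually_elim
      case (elim \<epsilon>)
      then show ?case using M[of "\<sigma> \<epsilon>"] \<sigma>_mem[of \<epsilon>] by (simp add: D_def assms(4))
    qed
  qed (simp add: D_def)
  have bound: "0 \<le> f \<epsilon>"
    "f \<epsilon> \<le> 16 * norm Y / T * \<epsilon> + 8 * (\<delta> + D \<epsilon> * (10 * norm K + 2 * norm B\<^sub>0 * norm Y))"
    if \<epsilon>: "\<epsilon> \<in> {0<..<1}" and small: "D \<epsilon> \<le> 1 / 2"
      and Y: "Y \<in> clinear_ops" "norm ((K o\<^sub>L P) - commutator B\<^sub>0 Y) \<le> \<delta>" for \<epsilon> \<delta> Y
  proof -
    let ?L = "\<Lambda> (\<sigma> \<epsilon>)"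
    note \<eta> = \<sigma>_mem[OF \<epsilon>]
    note L = small[unfolded D_def] and sa = assms(5)[OF \<eta>] and aut = assms(3)[OF \<eta>]
    have H: "Hcont (\<sigma> \<epsilon>) = ker_perp B\<^sub>0"
      by (simp only: assms(7,8,10)[OF \<eta>] orth_compl_ker_op[OF sa aut])
    have Q: "Pcont (\<sigma> \<epsilon>) = orth_proj_wrt (scalar_prod ?L) (ker_perp B\<^sub>0)"
      by (simp only: assms(7,11)[OF \<eta>] H)
    show "0 \<le> f \<epsilon>"
      unfolding f_def assms(7)[OF \<eta>] by (rule opnorm_wrt_near_id(1)[OF L])
    show "f \<epsilon> \<le> 16 * norm Y / T * \<epsilon> + 8 * (\<delta> + D \<epsilon> * (10 * norm K + 2 * norm B\<^sub>0 * norm Y))"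
      unfolding f_def D_def assms(7,8,12)[OF \<eta>] Q
      by (rule conjugated_average_bound[OF L sa assms(1) Y orth_proj_near_id[OF L P]
          inverse_op_near_id[OF L aut] _ \<open>T > 0\<close>]) (use \<epsilon> in auto)
  qed
  have "(f \<longlongrightarrow> 0) (at_right 0)"
  proof (rule tendstoI)
    fix e :: real assume "e > 0"
    then have e16: "e / 16 > 0" by simp
    obtain Y where Y: "Y \<in> clinear_ops" "norm ((K o\<^sub>L P) - commutator B\<^sub>0 Y) < e / 16"
      using compact_commutator_approximation[OF assms(1) spec K Pc P1 P(4) e16] by blast
    define g where "g \<epsilon> = 16 * norm Y / T * \<epsilon> + 8 * (e / 16 + D \<epsilon> * (10 * norm K + 2 * norm B\<^sub>0 * norm Y))" for \<epsilon>
    have "(g \<longlongrightarrow> 16 * norm Y / T * 0 + 8 * (e / 16 + 0 * (10 * norm K + 2 * norm B\<^sub>0 * norm Y))) (at_right 0)"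
      unfolding g_def by (intro tendsto_intros D_lim)
    then have "\<forall>\<^sub>F \<epsilon> in at_right 0. g \<epsilon> < e"
      by (rule order_tendstoD) (use \<open>e > 0\<close> in simp)
    moreover have "\<forall>\<^sub>F \<epsilon> in at_right 0. D \<epsilon> < 1 / 2" by (rule order_tendstoD[OF D_lim]) simp
    ultimately show "\<forall>\<^sub>F \<epsilon> in at_right 0. dist (f \<epsilon>) 0 < e"
      using ev01
    proof eventually_elim
      case (elim \<epsilon>)
      then have "D \<epsilon> \<le> 1 / 2" by simp
      from bound[OF elim(3) this Y(1) less_imp_le[OF Y(2)]] elim(1) show ?case
        by (simp add: g_def)
    qed
  qed
  then show ?thesis unfolding f_def[abs_def] .
qed

end
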